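(* Let $C$ be an arithmetic circuit of size $t$ and formal degree $d$ in which all multiplication gates are binary. There is a depth four circuit $\Gamma$ computing the same polynomial as $C$ with at most $(t^{\log_2(2d)}+1)^2+1$ unweighted addition gates and at most $2(t^{\log_2(2d)}+1)^{\sqrt{3d}+2}$ multiplication gates. There is a depth four arithmetic formula $\Gamma_f$ computing the same polynomial with at most $(t^{\log_2(2d)}+1)^{\sqrt{3d}}+1$ unweighted addition gates and at most $2(t^{\log_2(2d)}+1)^{2\sqrt{3d}}$ multiplication gates. The inputs of $\Gamma$ and $\Gamma_f$ are inputs of $C$ or constants, and their multiplication gates have fan-in at most $\sqrt{3d}+1$. If $C$ is constant-free and all the addition gates of $C$ are ordinary additions or subtractions, then these constants are integers of absolute value at most $2^t$.
   Context: An arithmetic circuit has input gates labelled by variables or field constants (each of fan-out at most 1), multiplication gates, and addition gates, which may be weighted (computing $\sum a_ix_i$ from inputs $x_i$ with weights $a_i$); ordinary addition and subtraction gates are binary with weights $(1,1)$ and $(1,-1)$. A circuit is constant-free if its only constants are from $\{-1,0,1\}$. Size is the number of gates including inputs. Formal degree: 1 for inputs, maximum of inputs' formal degrees for addition gates, sum for multiplication gates; the circuit's formal degree is that of its output. A depth four circuit is a $\Sigma\Pi\Sigma\Pi$ circuit with gates of unbounded fan-in: output gate an addition gate, whose inputs are multiplication gates, whose inputs are addition gates, whose inputs are multiplication gates taking input gates as inputs. An unweighted addition gate computes the sum of its inputs. A depth four formula is a depth four circuit where every non-output gate has fan-out one. *)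

theory Defs
  imports Complex_Main "HOL-Library.Poly_Mapping"
begin

type_synonym ('v, 'k) mpoly = "('v \<Rightarrow>\<^sub>0 nat) \<Rightarrow>\<^sub>0 'k"

definition mvar :: "'v \<Rightarrow> ('v, 'k::field) mpoly" where
  "mvar x = Poly_Mapping.single (Poly_Mapping.single x 1) 1"

definition mconst :: "'k::field \<Rightarrow> ('v, 'k) mpoly" where
  "mconst c = Poly_Mapping.single 0 c"

datatype ('v, 'k) label = Var 'v | Const 'k

text \<open>A circuit is a directed acyclic graph given as a list of gates in topological order: gates
  refer to their inputs by position in that list. Inputs are listed with multiplicity (so a gate can
  be squared), and an addition gate pairs every input with its weight.\<close>

datatype ('v, 'k) gate =
    Input "('v, 'k) label"
  | Mul "nat list"
  | Add "('k \<times> nat) list"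

datatype ('v, 'k) circuit = Circuit (gates: "('v, 'k) gate list") (out: nat)

fun args :: "('v, 'k) gate \<Rightarrow> nat list" where
  "args (Input l) = []"
| "args (Mul js) = js"
| "args (Add ws) = map snd ws"

fun is_input :: "('v, 'k) gate \<Rightarrow> bool" where
  "is_input (Input l) = True"
| "is_input (Mul js) = False"
| "is_input (Add ws) = False"

fun is_mul :: "('v, 'k) gate \<Rightarrow> bool" where
  "is_mul (Input l) = False"
| "is_mul (Mul js) = True"
| "is_mul (Add ws) = False"

fun is_add :: "('v, 'k) gate \<Rightarrow> bool" where
  "is_add (Input l) = False"
| "is_add (Mul js) = False"
| "is_add (Add ws) = True"

definition fan_in :: "('v, 'k) gate \<Rightarrow> nat" where
  "fan_in g = length (args g)"

definition fan_out :: "('v, 'k) circuit \<Rightarrow> nat \<Rightarrow> nat" where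
  "fan_out C i = (\<Sum>g\<leftarrow>gates C. count_list (args g) i)"

definition arithmetic_circuit :: "('v, 'k) circuit \<Rightarrow> bool" where
  "arithmetic_circuit C \<longleftrightarrow>
     out C < length (gates C) \<and>
     (\<forall>i < length (gates C). \<forall>j \<in> set (args (gates C ! i)). j < i) \<and>
     (\<forall>g \<in> set (gates C). \<not> is_input g \<longrightarrow> fan_in g \<ge> 1) \<and>
     (\<forall>i < length (gates C). is_input (gates C ! i) \<longrightarrow> fan_out C i \<le> 1)"

definition circuit_size :: "('v, 'k) circuit \<Rightarrow> nat" where
  "circuit_size C = length (gates C)"

definition num_mul :: "('v, 'k) circuit \<Rightarrow> nat" where
  "num_mul C = length (filter is_mul (gates C))"

definition num_add :: "('v, 'k) circuit \<Rightarrow> nat" where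
  "num_add C = length (filter is_add (gates C))"

fun label_poly :: "('v, 'k::field) label \<Rightarrow> ('v, 'k) mpoly" where
  "label_poly (Var x) = mvar x"
| "label_poly (Const c) = mconst c"

text \<open>In \<open>gate_poly\<close> and \<open>gate_degree\<close>, the list argument holds the values already obtained for
  all preceding gates.\<close>

fun gate_poly :: "('v, 'k::field) mpoly list \<Rightarrow> ('v, 'k) gate \<Rightarrow> ('v, 'k) mpoly" where
  "gate_poly ps (Input l) = label_poly l"
| "gate_poly ps (Mul js) = (\<Prod>j\<leftarrow>js. ps ! j)"
| "gate_poly ps (Add ws) = (\<Sum>(a, j)\<leftarrow>ws. mconst a * ps ! j)"

definition gate_polys :: "('v, 'k::field) gate list \<Rightarrow> ('v, 'k) mpoly list" where
  "gate_polys gs = foldl (\<lambda>ps g. ps @ [gate_poly ps g]) [] gs"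

definition circuit_poly :: "('v, 'k::field) circuit \<Rightarrow> ('v, 'k) mpoly" where
  "circuit_poly C = gate_polys (gates C) ! out C"

fun gate_degree :: "nat list \<Rightarrow> ('v, 'k) gate \<Rightarrow> nat" where
  "gate_degree ds (Input l) = 1"
| "gate_degree ds (Mul js) = (\<Sum>j\<leftarrow>js. ds ! j)"
| "gate_degree ds (Add ws) = Max ((\<lambda>(a, j). ds ! j) ` set ws)"

definition gate_degrees :: "('v, 'k) gate list \<Rightarrow> nat list" where
  "gate_degrees gs = foldl (\<lambda>ds g. ds @ [gate_degree ds g]) [] gs"

definition formal_degree :: "('v, 'k) circuit \<Rightarrow> nat" where
  "formal_degree C = gate_degrees (gates C) ! out C"

definition input_labels :: "('v, 'k) circuit \<Rightarrow> ('v, 'k) label set" where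
  "input_labels C = {l. Input l \<in> set (gates C)}"

definition binary_muls :: "('v, 'k) circuit \<Rightarrow> bool" where
  "binary_muls C \<longleftrightarrow> (\<forall>g \<in> set (gates C). is_mul g \<longrightarrow> fan_in g = 2)"

definition unweighted_adds :: "('v, 'k::field) circuit \<Rightarrow> bool" where
  "unweighted_adds C \<longleftrightarrow> (\<forall>ws. Add ws \<in> set (gates C) \<longrightarrow> (\<forall>(a, j) \<in> set ws. a = 1))"

definition ordinary_adds :: "('v, 'k::field) circuit \<Rightarrow> bool" where
  "ordinary_adds C \<longleftrightarrow>
     (\<forall>ws. Add ws \<in> set (gates C) \<longrightarrow> (\<exists>i j. ws = [(1, i), (1, j)] \<or> ws = [(1, i), (-1, j)]))"

definition constant_free :: "('v, 'k::field) circuit \<Rightarrow> bool" where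
  "constant_free C \<longleftrightarrow>
     (\<forall>c. Const c \<in> input_labels C \<longrightarrow> c \<in> {-1, 0, 1}) \<and>
     (\<forall>ws. Add ws \<in> set (gates C) \<longrightarrow> (\<forall>(a, j) \<in> set ws. a \<in> {-1, 0, 1}))"

text \<open>The witness \<open>lev\<close> assigns to every gate its layer: inputs in layer 0, then alternating layers
  of multiplications (1, 3) and additions (2, 4), with the output the only gate in layer 4.\<close>

definition depth_four_circuit :: "('v, 'k) circuit \<Rightarrow> bool" where
  "depth_four_circuit C \<longleftrightarrow>
     arithmetic_circuit C \<and>
     (\<exists>lev :: nat \<Rightarrow> nat.
        (\<forall>i < length (gates C).
           (lev i = 4 \<longleftrightarrow> i = out C) \<and>
           (is_input (gates C ! i) \<longrightarrow> lev i = 0) \<and>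
           (is_mul (gates C ! i) \<longrightarrow> lev i \<in> {1, 3}) \<and>
           (is_add (gates C ! i) \<longrightarrow> lev i \<in> {2, 4}) \<and>
           (\<forall>j \<in> set (args (gates C ! i)). lev i = Suc (lev j))))"

definition depth_four_formula :: "('v, 'k) circuit \<Rightarrow> bool" where
  "depth_four_formula C \<longleftrightarrow>
     depth_four_circuit C \<and>
     (\<forall>i < length (gates C). i \<noteq> out C \<longrightarrow> fan_out C i = 1)"

end

theory Submission
  imports Defs
begin

text \<open>Write every gate as a weighted sum of multiplication gates and inputs. Evaluating the circuit
  depth first, a stack of gates represents the product of their polynomials, and one step either
  emits the input on top or replaces the top gate by one of its summands, emitting the weight. If
  the factor of smaller degree is always treated first, the stack has height at most
  \<open>log 2 (2 * d)\<close>, so there are at most \<open>t powr log 2 (2 * d) + 1\<close> stacks, and every run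
  emits at most \<open>3 * d - 1\<close> labels. The polynomial is therefore an entry of the power
  \<open>M ^ (a * b)\<close>, with \<open>a * b \<ge> 3 * d - 1\<close>, of a matrix \<open>M\<close> of labels indexed by stacks;
  expanding it as \<open>(M ^ b) ^ a\<close> with \<open>a\<close> and \<open>b\<close> about \<open>sqrt (3 * d)\<close> gives depth four.\<close>

subsection \<open>Evaluation of circuits\<close>

text \<open>Paths through addition gates may be long without raising the degree, so a run that
  visited them one by one could not be bounded in terms of \<open>d\<close>. Hence whole paths of
  additions are collapsed beforehand, and their weights are added up into a single constant per
  transition. A matrix entry has to be one label, since it becomes one input gate. A weight and an
  input are therefore emitted in separate steps, which is why the run length is
  \<open>3 * d - 1\<close> and not \<open>2 * d - 1\<close>. Shorter runs are padded to a common
  length by a loop of label 1 at the empty stack; impossible transitions get label 0, so all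
  sequences of stacks may be listed, legal or not. The bound on the number of stacks is a single
  power plus one because the output gate occurs in no stack except \<open>[out C]\<close>: the other
  stacks use only \<open>t - 1\<close> gates, and the powers of \<open>t - 1\<close> up to the
  height sum to at most one power of \<open>t\<close>. In the circuit one block per pair of stacks
  is shared by all products. In the formula every product owns its blocks, which costs an extra
  factor, the number of blocks in a product.\<close>

lemma gate_polys_Nil [simp]: "gate_polys [] = []"
  by (simp add: gate_polys_def)

lemma gate_polys_snoc: "gate_polys (gs @ [g]) = gate_polys gs @ [gate_poly (gate_polys gs) g]"
  by (simp add: gate_polys_def)

lemma length_gate_polys [simp]: "length (gate_polys gs) = length gs"
  by (induction gs rule: rev_induct) (simp_all add: gate_polys_snoc)

lemma gate_poly_cong:
  assumes "\<And>j. j \<in> set (args g) \<Longrightarrow> ps ! j = qs ! j"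
  shows "gate_poly ps g = gate_poly qs g"
proof (cases g)
  case (Mul js)
  with assms show ?thesis by (auto cong: map_cong)
next
  case (Add ws)
  then have "map (\<lambda>(a, j). mconst a * ps ! j) ws = map (\<lambda>(a, j). mconst a * qs ! j) ws"
    using assms by force
  with Add show ?thesis by (simp only: gate_poly.simps)
qed simp

text \<open>Gates of one layer do not refer to each other, so each sees only the values of
  \<open>gs\<close>. The left fold can thus be evaluated one layer at a time.\<close>

lemma gate_polys_append_layer:
  assumes "\<And>g j. g \<in> set hs \<Longrightarrow> j \<in> set (args g) \<Longrightarrow> j < length gs"
  shows "gate_polys (gs @ hs) = gate_polys gs @ map (gate_poly (gate_polys gs)) hs"
  using assms
proof (induction hs rule: rev_induct)
  case (snoc h hs)
  have IH: "gate_polys (gs @ hs) = gate_polys gs @ map (gate_poly (gate_polys gs)) hs"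
    using snoc.prems by (intro snoc.IH) auto
  have "gate_poly (gate_polys (gs @ hs)) h = gate_poly (gate_polys gs) h"
    unfolding IH by (rule gate_poly_cong) (use snoc.prems in \<open>auto simp: nth_append\<close>)
  then show ?case
    using gate_polys_snoc[of "gs @ hs" h] IH by simp
qed simp

lemma gate_polys_take:
  "k \<le> length gs \<Longrightarrow> gate_polys (take k gs) = take k (gate_polys gs)"
proof (induction gs rule: rev_induct)
  case (snoc g gs)
  then show ?case by (cases "k \<le> length gs") (simp_all add: gate_polys_snoc)
qed simp

text \<open>The fold evaluates gate \<open>i\<close> on the values of the first \<open>i\<close>
  gates; as its arguments lie there, the full list of values gives the same result. This yields
  recursive equations in which the prefix no longer appears.\<close>

lemma gate_polys_nth:
  assumes "i < length gs" and "\<And>j. j \<in> set (args (gs ! i)) \<Longrightarrow> j < i"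
  shows "gate_polys gs ! i = gate_poly (gate_polys gs) (gs ! i)"
proof -
  have "gate_polys gs ! i = gate_polys (take (Suc i) gs) ! i"
    using assms(1) by (simp add: gate_polys_take)
  also have "\<dots> = gate_poly (take i (gate_polys gs)) (gs ! i)"
    using assms(1) by (simp add: take_Suc_conv_app_nth gate_polys_snoc nth_append gate_polys_take)
  also have "\<dots> = gate_poly (gate_polys gs) (gs ! i)"
    by (rule gate_poly_cong) (simp add: assms)
  finally show ?thesis .
qed

lemma gate_degrees_Nil [simp]: "gate_degrees [] = []"
  by (simp add: gate_degrees_def)

lemma gate_degrees_snoc: "gate_degrees (gs @ [g]) = gate_degrees gs @ [gate_degree (gate_degrees gs) g]"
  by (simp add: gate_degrees_def)

lemma length_gate_degrees [simp]: "length (gate_degrees gs) = length gs"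
  by (induction gs rule: rev_induct) (simp_all add: gate_degrees_snoc)

lemma gate_degree_cong:
  assumes "\<And>j. j \<in> set (args g) \<Longrightarrow> ps ! j = qs ! j"
  shows "gate_degree ps g = gate_degree qs g"
proof (cases g)
  case (Mul js)
  with assms show ?thesis by (auto cong: map_cong)
next
  case (Add ws)
  then have "(\<lambda>(a, j). ps ! j) ` set ws = (\<lambda>(a, j). qs ! j) ` set ws"
    using assms by (intro image_cong) force+
  with Add show ?thesis by simp
qed simp

lemma gate_degrees_take:
  "k \<le> length gs \<Longrightarrow> gate_degrees (take k gs) = take k (gate_degrees gs)"
proof (induction gs rule: rev_induct)
  case (snoc g gs)
  then show ?case by (cases "k \<le> length gs") (simp_all add: gate_degrees_snoc)
qed simp

lemma gate_degrees_nth: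
  assumes "i < length gs" and "\<And>j. j \<in> set (args (gs ! i)) \<Longrightarrow> j < i"
  shows "gate_degrees gs ! i = gate_degree (gate_degrees gs) (gs ! i)"
proof -
  have "gate_degrees gs ! i = gate_degrees (take (Suc i) gs) ! i"
    using assms(1) by (simp add: gate_degrees_take)
  also have "\<dots> = gate_degree (take i (gate_degrees gs)) (gs ! i)"
    using assms(1) by (simp add: take_Suc_conv_app_nth gate_degrees_snoc nth_append gate_degrees_take)
  also have "\<dots> = gate_degree (gate_degrees gs) (gs ! i)"
    by (rule gate_degree_cong) (simp add: assms)
  finally show ?thesis .
qed

lemma mconst_simps [simp]:
  "mconst 0 = 0" "mconst 1 = 1" "mconst (a + b) = mconst a + mconst b"
  "mconst (a * b) = mconst a * mconst b"
  by (simp_all add: mconst_def single_add mult_single)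

lemma mconst_sum: "mconst (\<Sum>x\<in>A. f x) = (\<Sum>x\<in>A. mconst (f x))"
  by (induction A rule: infinite_finite_induct) simp_all

subsection \<open>Depth four circuits from nested lists\<close>

text \<open>This is the wiring between layers: if \<open>concat xss\<close> is stored from position
  \<open>k\<close> on, the chunks are the intervals of positions that the inner lists occupy.
  Consecutive intervals are disjoint, so every stored gate is used exactly once.\<close>

primrec chunks :: "nat \<Rightarrow> 'a list list \<Rightarrow> nat list list" where
  "chunks k [] = []"
| "chunks k (xs # xss) = [k..<k + length xs] # chunks (k + length xs) xss"

lemma length_chunks [simp]: "length (chunks k xss) = length xss"
  by (induction xss arbitrary: k) simp_all

lemma map_length_chunks: "map length (chunks k xss) = map length xss"
  by (induction xss arbitrary: k) simp_all

lemma length_chunks_mem: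
  assumes "c \<in> set (chunks k xss)"
  shows "length c \<in> length ` set xss"
proof -
  from assms have "length c \<in> set (map length (chunks k xss))" by simp
  then show ?thesis unfolding map_length_chunks by simp
qed

lemma concat_chunks: "concat (chunks k xss) = [k..<k + length (concat xss)]"
proof (induction xss arbitrary: k)
  case (Cons xs xss)
  have "[k..<k + length xs] @ [k + length xs..<k + length xs + length (concat xss)]
    = [k..<k + length xs + length (concat xss)]"
    by (metis le_add1 upt_add_eq_append)
  then show ?case by (simp only: Cons chunks.simps concat.simps) (simp add: add.assoc)
qed simp

lemma chunks_map [simp]: "chunks k (map (map f) xss) = chunks k xss"
  by (induction xss arbitrary: k) simp_all

lemma chunks_nth: "map (map ((!) (us @ concat xss))) (chunks (length us) xss) = xss"
proof (induction xss arbitrary: us)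
  case (Cons xs xss)
  have "map ((!) (us @ xs @ concat xss)) [length us..<length us + length xs] = xs"
    by (rule nth_equalityI) (simp_all add: nth_append)
  then show ?case using Cons[of "us @ xs"] by simp
qed simp

lemma fan_out_eq_count: "fan_out C i = count_list (concat (map args (gates C))) i"
proof -
  have "count_list (concat xss) i = (\<Sum>xs\<leftarrow>xss. count_list xs i)" for xss :: "nat list list"
    by (induction xss) simp_all
  then show ?thesis by (simp add: fan_out_def comp_def)
qed

lemma count_list_upt: "count_list [m..<n] i = (if m \<le> i \<and> i < n then 1 else 0)"
  by (induction n) auto

text \<open>The lists in \<open>bs\<close> are sums of products of labels, and those in \<open>ms\<close> select by index the sums
  multiplied in layer three. Every product gets its own copies of its inputs.\<close>

definition depth4 :: "('v, 'k::field) label list list list \<Rightarrow> nat list list \<Rightarrow> ('v, 'k) circuit" where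
  "depth4 bs ms =
    (let qs = concat bs; ls = concat qs;
         n1 = length ls; n2 = n1 + length qs; n3 = n2 + length bs; n4 = n3 + length ms
     in Circuit
       (map Input ls @ map Mul (chunks 0 qs) @ map (\<lambda>c. Add (map (Pair 1) c)) (chunks n1 bs) @
        map (\<lambda>m. Mul (map ((+) n2) m)) ms @ [Add (map (Pair 1) [n3..<n4])]) n4)"

locale depth4_data =
  fixes bs :: "('v, 'k::field) label list list list" and ms :: "nat list list"
  assumes factors_nonempty: "[] \<notin> set (concat bs)"
    and summands_nonempty: "[] \<notin> set bs"
    and indices_nonempty: "[] \<notin> set ms"
    and products_nonempty: "ms \<noteq> []"
    and indices_less: "\<And>m j. m \<in> set ms \<Longrightarrow> j \<in> set m \<Longrightarrow> j < length bs"
begin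

definition "qs = concat bs"
definition "ls = concat qs"
definition "n1 = length ls"
definition "n2 = n1 + length qs"
definition "n3 = n2 + length bs"
definition "n4 = n3 + length ms"
definition L0 :: "('v, 'k) gate list" where "L0 = map Input ls"
definition L1 :: "('v, 'k) gate list" where "L1 = map Mul (chunks 0 qs)"
definition L2 :: "('v, 'k) gate list" where "L2 = map (\<lambda>c. Add (map (Pair 1) c)) (chunks n1 bs)"
definition L3 :: "('v, 'k) gate list" where "L3 = map (\<lambda>m. Mul (map ((+) n2) m)) ms"
definition g4 :: "('v, 'k) gate" where "g4 = Add (map (Pair 1) [n3..<n4])"

lemma gates_depth4: "gates (depth4 bs ms) = L0 @ L1 @ L2 @ L3 @ [g4]"
  by (simp add: depth4_def L0_def L1_def L2_def L3_def g4_def n4_def n3_def n2_def n1_def ls_def qs_def Let_def)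

lemma out_depth4: "out (depth4 bs ms) = n4"
  by (simp add: depth4_def n4_def n3_def n2_def n1_def ls_def qs_def Let_def)

lemma layer_lengths [simp]:
  "length L0 = n1" "length L1 = length qs" "length L2 = length bs" "length L3 = length ms"
  by (simp_all add: L0_def L1_def L2_def L3_def n1_def)

lemma args_L1: "concat (map args L1) = [0..<n1]"
  by (simp add: L1_def comp_def concat_chunks ls_def n1_def)

lemma args_L2: "concat (map args L2) = [n1..<n2]"
  by (simp add: L2_def comp_def concat_chunks n2_def qs_def)

lemma args_L3: "concat (map args L3) = map ((+) n2) (concat ms)"
  by (simp add: L3_def comp_def map_concat)

text \<open>Fan-outs are multiplicities in this one list. The intervals contribute 1 to each of
  their positions, so only the middle part, the use of layer two by layer three, can produce another
  fan-out.\<close>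

lemma args_all:
  "concat (map args (gates (depth4 bs ms))) = [0..<n2] @ map ((+) n2) (concat ms) @ [n3..<n4]"
proof -
  have "concat (map args L0) = []" by (simp add: L0_def comp_def)
  moreover have "[0..<n2] = [0..<n1] @ [n1..<n2]"
    using upt_add_eq_append[of 0 n1 "length qs"] by (simp add: n2_def)
  ultimately show ?thesis
    by (simp add: gates_depth4 args_L1 args_L2 args_L3) (simp add: g4_def comp_def)
qed

lemma args_bounds:
  "g \<in> set L0 \<Longrightarrow> args g = []"
  "g \<in> set L1 \<Longrightarrow> j \<in> set (args g) \<Longrightarrow> j < n1"
  "g \<in> set L2 \<Longrightarrow> j \<in> set (args g) \<Longrightarrow> n1 \<le> j \<and> j < n2"
  "g \<in> set L3 \<Longrightarrow> j \<in> set (args g) \<Longrightarrow> n2 \<le> j \<and> j < n3"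
  "j \<in> set (args g4) \<Longrightarrow> n3 \<le> j \<and> j < n4"
proof -
  have *: "j \<in> set (concat (map args L))" if "g \<in> set L" "j \<in> set (args g)" for L
    using that by auto
  show "g \<in> set L0 \<Longrightarrow> args g = []" by (auto simp: L0_def)
  show "g \<in> set L1 \<Longrightarrow> j \<in> set (args g) \<Longrightarrow> j < n1"
    using * args_L1 by fastforce
  show "g \<in> set L2 \<Longrightarrow> j \<in> set (args g) \<Longrightarrow> n1 \<le> j \<and> j < n2"
    using * args_L2 by fastforce
  show "g \<in> set L3 \<Longrightarrow> j \<in> set (args g) \<Longrightarrow> n2 \<le> j \<and> j < n3"
    using indices_less by (auto simp: L3_def n3_def)
  show "j \<in> set (args g4) \<Longrightarrow> n3 \<le> j \<and> j < n4"
    by (auto simp: g4_def)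
qed

lemma kinds:
  "g \<in> set L0 \<Longrightarrow> is_input g \<and> \<not> is_mul g \<and> \<not> is_add g"
  "g \<in> set L1 \<Longrightarrow> \<not> is_input g \<and> is_mul g \<and> \<not> is_add g"
  "g \<in> set L2 \<Longrightarrow> \<not> is_input g \<and> \<not> is_mul g \<and> is_add g"
  "g \<in> set L3 \<Longrightarrow> \<not> is_input g \<and> is_mul g \<and> \<not> is_add g"
  "\<not> is_input g4 \<and> \<not> is_mul g4 \<and> is_add g4"
  by (auto simp: L0_def L1_def L2_def L3_def g4_def)

lemma gate_cases:
  assumes "i < length (gates (depth4 bs ms))"
  obtains "i < n1" "gates (depth4 bs ms) ! i \<in> set L0"
  | "n1 \<le> i" "i < n2" "gates (depth4 bs ms) ! i \<in> set L1"
  | "n2 \<le> i" "i < n3" "gates (depth4 bs ms) ! i \<in> set L2"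
  | "n3 \<le> i" "i < n4" "gates (depth4 bs ms) ! i \<in> set L3"
  | "i = n4" "gates (depth4 bs ms) ! i = g4"
proof -
  consider "i < n1" | "n1 \<le> i" "i < n2" | "n2 \<le> i" "i < n3" | "n3 \<le> i" "i < n4" | "i = n4"
    using assms by (simp add: gates_depth4 n2_def n3_def n4_def) linarith
  then show thesis
  proof cases
    case 1
    then show thesis by (intro that(1)) (auto simp: gates_depth4 nth_append n2_def n3_def n4_def)
  next
    case 2
    then show thesis by (intro that(2)) (auto simp: gates_depth4 nth_append n2_def n3_def n4_def)
  next
    case 3
    then show thesis by (intro that(3)) (auto simp: gates_depth4 nth_append n2_def n3_def n4_def)
  next
    case 4
    then show thesis by (intro that(4)) (auto simp: gates_depth4 nth_append n2_def n3_def n4_def)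
  next
    case 5
    then show thesis by (intro that(5)) (auto simp: gates_depth4 nth_append n2_def n3_def n4_def)
  qed
qed

lemma num_add_depth4: "num_add (depth4 bs ms) = length bs + 1"
proof -
  have "filter is_add L0 = []" "filter is_add L1 = []" "filter is_add L3 = []" "filter is_add L2 = L2"
    using kinds by (auto simp: filter_empty_conv filter_id_conv)
  then show ?thesis using kinds(5) by (simp add: num_add_def gates_depth4)
qed

lemma num_mul_depth4: "num_mul (depth4 bs ms) = length (concat bs) + length ms"
proof -
  have "filter is_mul L0 = []" "filter is_mul L2 = []" "filter is_mul L1 = L1" "filter is_mul L3 = L3"
    using kinds by (auto simp: filter_empty_conv filter_id_conv)
  then show ?thesis using kinds(5) by (simp add: num_mul_def gates_depth4 qs_def)
qed

lemma input_labels_depth4: "input_labels (depth4 bs ms) = set (concat (concat bs))"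
  by (auto simp: input_labels_def gates_depth4 L0_def L1_def L2_def L3_def g4_def ls_def qs_def)

lemma fan_in_mul_depth4:
  assumes "g \<in> set (gates (depth4 bs ms))" "is_mul g"
  shows "fan_in g \<in> length ` set (concat bs) \<union> length ` set ms"
  using assms length_chunks_mem[of _ 0 qs]
  by (fastforce simp: gates_depth4 L0_def L1_def L2_def L3_def g4_def fan_in_def qs_def)

lemma unweighted_depth4: "unweighted_adds (depth4 bs ms)"
  by (auto simp: unweighted_adds_def gates_depth4 L0_def L1_def L2_def L3_def g4_def)

lemma fan_in_pos:
  assumes "g \<in> set (gates (depth4 bs ms))" "\<not> is_input g"
  shows "fan_in g \<ge> 1"
proof -
  have "n3 < n4" using products_nonempty by (simp add: n4_def)
  moreover have "[] \<notin> set (chunks 0 qs)"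
    using length_chunks_mem[of "[]" 0 qs] factors_nonempty by (auto simp: qs_def)
  moreover have "[] \<notin> set (chunks n1 bs)"
    using length_chunks_mem[of "[]" n1 bs] summands_nonempty by auto
  ultimately show ?thesis
    using assms indices_nonempty
    by (auto simp: gates_depth4 L0_def L1_def L2_def L3_def g4_def fan_in_def Suc_le_eq)
qed

lemma fan_out_small: "i < n2 \<Longrightarrow> fan_out (depth4 bs ms) i = 1"
  using count_notin[of i "map ((+) n2) (concat ms)"]
  by (fastforce simp: fan_out_eq_count args_all count_list_upt n3_def)

lemma depth_four: "depth_four_circuit (depth4 bs ms)"
proof -
  define lev :: "nat \<Rightarrow> nat" where
    "lev i = (if i < n1 then 0 else if i < n2 then 1 else if i < n3 then 2 else if i < n4 then 3 else 4)" for i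
  have le: "n1 \<le> n2" "n2 \<le> n3" "n3 \<le> n4" by (simp_all add: n2_def n3_def n4_def)
  have len: "length (gates (depth4 bs ms)) = Suc n4"
    by (simp add: gates_depth4 n2_def n3_def n4_def)
  have "arithmetic_circuit (depth4 bs ms)"
    unfolding arithmetic_circuit_def
  proof (intro conjI allI impI ballI)
    fix i j
    assume i: "i < length (gates (depth4 bs ms))" and j: "j \<in> set (args (gates (depth4 bs ms) ! i))"
    from i show "j < i"
    proof (cases rule: gate_cases)
      case 1
      then show ?thesis using j args_bounds(1) by simp
    next
      case 2
      then show ?thesis using args_bounds(2)[OF _ j] by simp
    next
      case 3
      then show ?thesis using args_bounds(3)[OF _ j] by simp
    next
      case 4
      then show ?thesis using args_bounds(4)[OF _ j] by simp
    next
      case 5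
      then show ?thesis using args_bounds(5)[of j] j by simp
    qed
  next
    fix i
    assume i: "i < length (gates (depth4 bs ms))" and inp: "is_input (gates (depth4 bs ms) ! i)"
    from i have "i < n1" by (cases rule: gate_cases) (use kinds inp in auto)
    then show "fan_out (depth4 bs ms) i \<le> 1" using fan_out_small le by simp
  qed (use fan_in_pos in \<open>simp_all add: out_depth4 len\<close>)
  moreover have "(lev i = 4 \<longleftrightarrow> i = out (depth4 bs ms)) \<and>
       (is_input (gates (depth4 bs ms) ! i) \<longrightarrow> lev i = 0) \<and>
       (is_mul (gates (depth4 bs ms) ! i) \<longrightarrow> lev i \<in> {1, 3}) \<and>
       (is_add (gates (depth4 bs ms) ! i) \<longrightarrow> lev i \<in> {2, 4}) \<and>
       (\<forall>j \<in> set (args (gates (depth4 bs ms) ! i)). lev i = Suc (lev j))"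
    if "i < length (gates (depth4 bs ms))" for i
    using that
  proof (cases rule: gate_cases)
    case 1
    then show ?thesis using kinds(1) args_bounds(1) le by (auto simp: lev_def out_depth4)
  next
    case 2
    then show ?thesis using kinds(2) args_bounds(2) le by (auto simp: lev_def out_depth4)
  next
    case 3
    then show ?thesis using kinds(3) le by (auto simp: lev_def out_depth4 dest!: args_bounds(3))
  next
    case 4
    then show ?thesis using kinds(4) le by (auto simp: lev_def out_depth4 dest!: args_bounds(4))
  next
    case 5
    then show ?thesis using kinds(5) le by (auto simp: lev_def out_depth4 dest!: args_bounds(5))
  qed
  ultimately show ?thesis unfolding depth_four_circuit_def by blast
qed

text \<open>Under the hypothesis the middle part of \<open>args_all\<close> is the interval of layer
  two, and the three parts together list every position below \<open>n4\<close> once.\<close>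

lemma depth_four_formula:
  assumes "concat ms = [0..<length bs]"
  shows "depth_four_formula (depth4 bs ms)"
proof -
  have "map ((+) n2) (concat ms) = [n2..<n3]"
    unfolding assms by (rule nth_equalityI) (simp_all add: n3_def)
  then have "fan_out (depth4 bs ms) i = 1" if "i < n4" for i
    using that by (auto simp: fan_out_eq_count args_all count_list_upt n3_def)
  moreover have "length (gates (depth4 bs ms)) = Suc n4"
    by (simp add: gates_depth4 n2_def n3_def n4_def)
  ultimately show ?thesis
    using depth_four by (auto simp: depth_four_formula_def out_depth4 less_Suc_eq)
qed

definition block_poly :: "('v, 'k) label list list \<Rightarrow> ('v, 'k) mpoly" where
  "block_poly b = (\<Sum>q\<leftarrow>b. \<Prod>l\<leftarrow>q. label_poly l)"

text \<open>Evaluate layer by layer. For the layers wired by \<open>chunks\<close>,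
  \<open>chunks_nth\<close> with the earlier values as \<open>us\<close> returns the original nested
  lists; layer three is wired by explicit indices shifted by \<open>n2\<close>.\<close>

lemma circuit_poly_depth4:
  "circuit_poly (depth4 bs ms) = (\<Sum>m\<leftarrow>ms. \<Prod>j\<leftarrow>m. block_poly (bs ! j))"
proof -
  define P0 where "P0 = map label_poly ls"
  define P1 where "P1 = map (\<lambda>q. \<Prod>l\<leftarrow>q. label_poly l) qs"
  define P2 where "P2 = map block_poly bs"
  define P3 where "P3 = map (\<lambda>m. \<Prod>j\<leftarrow>m. block_poly (bs ! j)) ms"
  have lens: "length P0 = n1" "length P1 = length qs" "length P2 = length bs" "length P3 = length ms"
    by (simp_all add: P0_def P1_def P2_def P3_def n1_def)
  have p0: "gate_polys L0 = P0"
    using gate_polys_append_layer[of L0 "[]"] args_bounds(1) by (simp add: L0_def P0_def)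
  have "map (map ((!) P0)) (chunks 0 qs) = map (map label_poly) qs"
    using chunks_nth[of "[]" "map (map label_poly) qs"] by (simp add: P0_def ls_def map_concat)
  then have "map prod_list (map (map ((!) P0)) (chunks 0 qs)) = P1"
    by (simp add: P1_def comp_def)
  then have "map (gate_poly P0) L1 = P1"
    by (simp add: L1_def comp_def)
  then have p1: "gate_polys (L0 @ L1) = P0 @ P1"
    using gate_polys_append_layer[of L1 L0] args_bounds(2) p0 by simp
  have "map (map ((!) (P0 @ P1))) (chunks n1 bs) = map (map (\<lambda>q. \<Prod>l\<leftarrow>q. label_poly l)) bs"
    using chunks_nth[of P0 "map (map (\<lambda>q. \<Prod>l\<leftarrow>q. label_poly l)) bs"]
    by (simp add: P1_def lens qs_def map_concat)
  then have "map sum_list (map (map ((!) (P0 @ P1))) (chunks n1 bs)) = P2"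
    by (simp add: P2_def block_poly_def comp_def)
  then have "map (gate_poly (P0 @ P1)) L2 = P2"
    by (simp add: L2_def comp_def)
  then have p2: "gate_polys (L0 @ L1 @ L2) = P0 @ P1 @ P2"
    using gate_polys_append_layer[of L2 "L0 @ L1"] args_bounds(3) p1 by (simp add: n2_def)
  have "map ((!) (P0 @ P1 @ P2)) (map ((+) n2) m) = map (\<lambda>j. block_poly (bs ! j)) m" if "m \<in> set ms" for m
    using indices_less[OF that] by (auto simp: nth_append lens n2_def P2_def)
  then have "gate_poly (P0 @ P1 @ P2) (Mul (map ((+) n2) m)) = (\<Prod>j\<leftarrow>m. block_poly (bs ! j))"
    if "m \<in> set ms" for m
    using that by (simp only: gate_poly.simps)
  then have "map (gate_poly (P0 @ P1 @ P2)) L3 = P3"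
    by (simp add: L3_def P3_def)
  then have p3: "gate_polys (L0 @ L1 @ L2 @ L3) = P0 @ P1 @ P2 @ P3"
    using gate_polys_append_layer[of L3 "L0 @ L1 @ L2"] args_bounds(4) p2 by (simp add: n2_def n3_def add.assoc)
  have "map ((!) (P0 @ P1 @ P2 @ P3)) [n3..<n4] = P3"
    by (rule nth_equalityI) (simp_all add: nth_append lens n2_def n3_def n4_def)
  then have "gate_poly (P0 @ P1 @ P2 @ P3) g4 = sum_list P3"
    by (simp add: g4_def comp_def)
  then have "gate_polys (gates (depth4 bs ms)) = P0 @ P1 @ P2 @ P3 @ [sum_list P3]"
    using gate_polys_snoc[of "L0 @ L1 @ L2 @ L3" g4] p3 by (simp add: gates_depth4)
  then show ?thesis
    by (simp add: circuit_poly_def out_depth4 nth_append lens n2_def n3_def n4_def P3_def)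
qed

end

subsection \<open>Matrix powers as sums over walks\<close>

primrec mpow :: "'s set \<Rightarrow> ('s \<Rightarrow> 's \<Rightarrow> 'r::comm_semiring_1) \<Rightarrow> nat \<Rightarrow> 's \<Rightarrow> 's \<Rightarrow> 'r" where
  "mpow S M 0 i j = of_bool (i = j)"
| "mpow S M (Suc k) i j = (\<Sum>x\<in>S. M i x * mpow S M k x j)"

lemma mpow_add:
  assumes "finite S" "i \<in> S"
  shows "mpow S M (k + l) i j = (\<Sum>x\<in>S. mpow S M k i x * mpow S M l x j)"
  using assms(2)
proof (induction k arbitrary: i)
  case 0
  then have "(\<Sum>x\<in>S. mpow S M 0 i x * mpow S M l x j) = (\<Sum>x\<in>S. if i = x then mpow S M l x j else 0)"
    by (intro sum.cong) auto
  with 0 assms(1) show ?case by simp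
next
  case (Suc k)
  have "mpow S M (Suc k + l) i j = (\<Sum>y\<in>S. M i y * (\<Sum>x\<in>S. mpow S M k y x * mpow S M l x j))"
    using Suc.IH by (auto intro: sum.cong)
  also have "\<dots> = (\<Sum>y\<in>S. \<Sum>x\<in>S. M i y * mpow S M k y x * mpow S M l x j)"
    by (simp add: sum_distrib_left mult.assoc)
  also have "\<dots> = (\<Sum>x\<in>S. \<Sum>y\<in>S. M i y * mpow S M k y x * mpow S M l x j)"
    by (rule sum.swap)
  finally show ?case by (simp add: sum_distrib_right)
qed

lemma mpow_mult:
  assumes "finite S" "i \<in> S"
  shows "mpow S (mpow S M b) a i j = mpow S M (a * b) i j"
  using assms(2)
proof (induction a arbitrary: i)
  case (Suc a)
  have "mpow S M (Suc a * b) i j = (\<Sum>x\<in>S. mpow S M b i x * mpow S M (a * b) x j)"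
    using mpow_add[OF assms(1) Suc.prems] by simp
  also have "\<dots> = mpow S (mpow S M b) (Suc a) i j"
    using Suc.IH by (auto intro: sum.cong)
  finally show ?case by simp
qed simp

text \<open>Iterating \<open>v = M v\<close> gives \<open>v = M^k v\<close>. Each step with a
  nonzero entry lowers the measure, so after \<open>k\<close> steps only walks that end in
  \<open>z\<close> survive, and \<open>v z = 1\<close>. The truncated subtraction in the second
  hypothesis admits the loop at \<open>z\<close>, where the measure stays 0.\<close>

lemma fixed_vector_eq_mpow:
  fixes M :: "'s \<Rightarrow> 's \<Rightarrow> 'r::comm_semiring_1" and \<mu> :: "'s \<Rightarrow> nat"
  assumes "\<And>s. s \<in> S \<Longrightarrow> v s = (\<Sum>x\<in>S. M s x * v x)"
    and "\<And>s x. s \<in> S \<Longrightarrow> x \<in> S \<Longrightarrow> M s x \<noteq> 0 \<Longrightarrow> \<mu> x \<le> \<mu> s - 1"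
    and "\<And>s. s \<in> S \<Longrightarrow> \<mu> s = 0 \<Longrightarrow> s = z" and "v z = 1"
    and "s \<in> S" and "\<mu> s \<le> k"
  shows "v s = mpow S M k s z"
  using assms(5,6)
proof (induction k arbitrary: s)
  case 0
  then have "s = z" using assms(3) by simp
  then show ?case using assms(4) by simp
next
  case (Suc k)
  have "M s x * v x = M s x * mpow S M k x z" if "x \<in> S" for x
  proof (cases "M s x = 0")
    case False
    then have "\<mu> x \<le> k" using assms(2)[OF Suc.prems(1) that] Suc.prems(2) by simp
    then show ?thesis using Suc.IH that by simp
  qed simp
  then show ?case using assms(1)[OF Suc.prems(1)] by (simp cong: sum.cong)
qed

primrec walk_edges :: "'s \<Rightarrow> 's list \<Rightarrow> 's \<Rightarrow> ('s \<times> 's) list" where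
  "walk_edges i [] j = [(i, j)]"
| "walk_edges i (x # xs) j = (i, x) # walk_edges x xs j"

lemma length_walk_edges [simp]: "length (walk_edges i xs j) = Suc (length xs)"
  by (induction xs arbitrary: i) simp_all

lemma walk_edges_subset:
  "i \<in> S \<Longrightarrow> j \<in> S \<Longrightarrow> set xs \<subseteq> S \<Longrightarrow> set (walk_edges i xs j) \<subseteq> S \<times> S"
  by (induction xs arbitrary: i) auto

lemma sum_list_sum_swap:
  fixes f :: "'s \<Rightarrow> 't \<Rightarrow> 'r::comm_monoid_add"
  shows "(\<Sum>y\<leftarrow>ys. \<Sum>x\<in>A. f x y) = (\<Sum>x\<in>A. \<Sum>y\<leftarrow>ys. f x y)"
  by (induction ys) (simp_all add: sum.distrib)

lemma sum_list_n_lists_Suc: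
  fixes f :: "'s list \<Rightarrow> 'r::comm_monoid_add"
  assumes "distinct xs"
  shows "(\<Sum>ys\<leftarrow>List.n_lists (Suc k) xs. f ys) = (\<Sum>x\<in>set xs. \<Sum>ys\<leftarrow>List.n_lists k xs. f (x # ys))"
proof -
  have "(\<Sum>ys\<leftarrow>List.n_lists (Suc k) xs. f ys) = (\<Sum>ys\<leftarrow>List.n_lists k xs. \<Sum>x\<leftarrow>xs. f (x # ys))"
  proof -
    have "sum_list (concat yss) = (\<Sum>ys\<leftarrow>yss. sum_list ys)" for yss :: "'r list list"
      by (induction yss) simp_all
    then show ?thesis by (simp add: map_concat comp_def)
  qed
  also have "\<dots> = (\<Sum>ys\<leftarrow>List.n_lists k xs. \<Sum>x\<in>set xs. f (x # ys))"
    using assms by (simp add: sum_list_distinct_conv_sum_set)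
  also have "\<dots> = (\<Sum>x\<in>set xs. \<Sum>ys\<leftarrow>List.n_lists k xs. f (x # ys))"
    by (rule sum_list_sum_swap)
  finally show ?thesis .
qed

text \<open>\<open>k\<close> counts the intermediate vertices, so the walks have
  \<open>Suc k\<close> edges. The statement is kept general in \<open>M\<close> because it is used
  at both levels: for the matrix of labels inside a block, and for a power of that matrix across
  blocks.\<close>

lemma sum_walks_eq_mpow:
  fixes M :: "'s \<Rightarrow> 's \<Rightarrow> 'r::comm_semiring_1"
  assumes "distinct xs" "j \<in> set xs"
  shows "(\<Sum>ys\<leftarrow>List.n_lists k xs. \<Prod>(x, y)\<leftarrow>walk_edges i ys j. M x y) = mpow (set xs) M (Suc k) i j"
proof (induction k arbitrary: i)
  case 0
  have "(\<Sum>x\<in>set xs. M i x * of_bool (x = j)) = (\<Sum>x\<in>set xs. if x = j then M i x else 0)"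
    by (intro sum.cong) auto
  then show ?case using assms(2) by simp
next
  case (Suc k)
  have "(\<Sum>ys\<leftarrow>List.n_lists (Suc k) xs. \<Prod>(x, y)\<leftarrow>walk_edges i ys j. M x y)
    = (\<Sum>x\<in>set xs. \<Sum>ys\<leftarrow>List.n_lists k xs. M i x * (\<Prod>(x, y)\<leftarrow>walk_edges x ys j. M x y))"
    unfolding sum_list_n_lists_Suc[OF assms(1)] by simp
  also have "\<dots> = (\<Sum>x\<in>set xs. M i x * mpow (set xs) M (Suc k) x j)"
    unfolding sum_list_const_mult Suc ..
  finally show ?case by simp
qed

section \<open>Depth four circuits and formulas for an entry of a matrix power\<close>

definition walk_block ::
  "('s \<Rightarrow> 's \<Rightarrow> ('v, 'k) label) \<Rightarrow> 's list \<Rightarrow> nat \<Rightarrow> 's \<times> 's \<Rightarrow> ('v, 'k) label list list" where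
  "walk_block w xs k e =
     map (\<lambda>ys. map (\<lambda>(x, y). w x y) (walk_edges (fst e) ys (snd e))) (List.n_lists k xs)"

lemma length_concat_map_const:
  "(\<And>x. x \<in> set ys \<Longrightarrow> length (f x) = c) \<Longrightarrow> length (concat (map f ys)) = length ys * c"
  by (induction ys) auto

context
  fixes w :: "'s \<Rightarrow> 's \<Rightarrow> ('v, 'k::field) label" and xs :: "'s list" and i j :: 's and k l :: nat
  assumes xs: "distinct xs" and ij: "i \<in> set xs" "j \<in> set xs"
begin

definition "walks = map (\<lambda>ys. walk_edges i ys j) (List.n_lists k xs)"

lemma xs_nonempty: "length xs > 0" using ij by auto

lemma walks_props:
  "length walks = length xs ^ k" "\<And>p. p \<in> set walks \<Longrightarrow> length p = Suc k \<and> set p \<subseteq> set xs \<times> set xs"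
proof -
  show "length walks = length xs ^ k" by (simp add: walks_def length_n_lists)
  fix p assume "p \<in> set walks"
  then obtain ys where ys: "p = walk_edges i ys j" "length ys = k" "set ys \<subseteq> set xs"
    by (auto simp: walks_def set_n_lists)
  then show "length p = Suc k \<and> set p \<subseteq> set xs \<times> set xs"
    using walk_edges_subset[OF ij ys(3)] by simp
qed

lemma walk_block_props:
  "length (walk_block w xs l e) = length xs ^ l"
  "q \<in> set (walk_block w xs l e) \<Longrightarrow> length q = Suc l"
  "e \<in> set xs \<times> set xs \<Longrightarrow> q \<in> set (walk_block w xs l e) \<Longrightarrow> a \<in> set q \<Longrightarrow> \<exists>x\<in>set xs. \<exists>y. a = w x y"
proof -
  show "length (walk_block w xs l e) = length xs ^ l" by (simp add: walk_block_def length_n_lists)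
  show "q \<in> set (walk_block w xs l e) \<Longrightarrow> length q = Suc l"
    by (auto simp: walk_block_def set_n_lists)
  assume e: "e \<in> set xs \<times> set xs" and "q \<in> set (walk_block w xs l e)" "a \<in> set q"
  then obtain ys x y where *: "set ys \<subseteq> set xs" "(x, y) \<in> set (walk_edges (fst e) ys (snd e))" "a = w x y"
    by (auto simp: walk_block_def set_n_lists)
  then have "x \<in> set xs" using walk_edges_subset[of "fst e" "set xs" "snd e" ys] e by auto
  with * show "\<exists>x\<in>set xs. \<exists>y. a = w x y" by blast
qed

lemma walk_block_nonempty: "walk_block w xs l e \<noteq> []"
  using walk_block_props(1)[of e] xs_nonempty by auto

lemma walk_block_poly:
  assumes "y \<in> set xs"
  shows "(\<Sum>q\<leftarrow>walk_block w xs l (x, y). \<Prod>a\<leftarrow>q. label_poly a)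
    = mpow (set xs) (\<lambda>x y. label_poly (w x y)) (Suc l) x y"
  using sum_walks_eq_mpow[OF xs assms, of "\<lambda>x y. label_poly (w x y)" x l]
  by (simp add: walk_block_def comp_def case_prod_unfold)

lemma walks_poly:
  "(\<Sum>p\<leftarrow>walks. \<Prod>e\<leftarrow>p. \<Sum>q\<leftarrow>walk_block w xs l e. \<Prod>a\<leftarrow>q. label_poly a)
    = mpow (set xs) (\<lambda>x y. label_poly (w x y)) (Suc k * Suc l) i j"
proof -
  let ?M = "\<lambda>x y. label_poly (w x y)"
  have "(\<Sum>p\<leftarrow>walks. \<Prod>e\<leftarrow>p. \<Sum>q\<leftarrow>walk_block w xs l e. \<Prod>a\<leftarrow>q. label_poly a)
    = (\<Sum>p\<leftarrow>walks. \<Prod>(x, y)\<leftarrow>p. mpow (set xs) ?M (Suc l) x y)"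
  proof (intro arg_cong[of _ _ sum_list] map_cong refl arg_cong[of _ _ prod_list])
    fix p e assume "p \<in> set walks" "e \<in> set p"
    then have "snd e \<in> set xs" using walks_props(2) by fastforce
    then show "(\<Sum>q\<leftarrow>walk_block w xs l e. \<Prod>a\<leftarrow>q. label_poly a)
      = (case e of (x, y) \<Rightarrow> mpow (set xs) ?M (Suc l) x y)"
      using walk_block_poly[of "snd e" "fst e"] by (simp add: case_prod_unfold del: mpow.simps)
  qed
  also have "\<dots> = mpow (set xs) (mpow (set xs) ?M (Suc l)) (Suc k) i j"
    using sum_walks_eq_mpow[OF xs ij(2), of "mpow (set xs) ?M (Suc l)" i k]
    by (simp add: walks_def comp_def del: mpow.simps)
  also have "\<dots> = mpow (set xs) ?M (Suc k * Suc l) i j"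
    by (rule mpow_mult) (use ij in auto)
  finally show ?thesis .
qed

lemma depth_four_circuit_of_mpow:
  obtains \<Gamma> where "depth_four_circuit \<Gamma>"
    "circuit_poly \<Gamma> = mpow (set xs) (\<lambda>x y. label_poly (w x y)) (Suc k * Suc l) i j"
    "unweighted_adds \<Gamma>"
    "num_add \<Gamma> = length xs ^ 2 + 1"
    "num_mul \<Gamma> = length xs ^ 2 * length xs ^ l + length xs ^ k"
    "\<And>a. a \<in> input_labels \<Gamma> \<Longrightarrow> \<exists>x\<in>set xs. \<exists>y. a = w x y"
    "\<And>g. g \<in> set (gates \<Gamma>) \<Longrightarrow> is_mul g \<Longrightarrow> fan_in g \<in> {Suc k, Suc l}"
proof -
  \<comment> \<open>One block for each pair of stacks, shared by all products of layer three: this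
    is the source of the square in the number of additions.\<close>
  define es where "es = List.product xs xs"
  have set_es: "set es = set xs \<times> set xs" by (simp add: es_def)
  have "\<forall>e. \<exists>n. e \<in> set es \<longrightarrow> n < length es \<and> es ! n = e" by (metis in_set_conv_nth)
  then obtain idx where idx: "\<And>e. e \<in> set es \<Longrightarrow> idx e < length es \<and> es ! idx e = e" by metis
  define bs where "bs = map (walk_block w xs l) es"
  define ms where "ms = map (map idx) walks"
  interpret depth4_data bs ms
  proof
    show "[] \<notin> set (concat bs)" using walk_block_props(2) by (fastforce simp: bs_def)
    show "[] \<notin> set bs" using walk_block_nonempty[symmetric] by (auto simp: bs_def)
    show "[] \<notin> set ms" using walks_props(2) by (fastforce simp: ms_def)
    show "ms \<noteq> []" using walks_props(1) xs_nonempty by (auto simp: ms_def)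
    show "m \<in> set ms \<Longrightarrow> n \<in> set m \<Longrightarrow> n < length bs" for m n
      using walks_props(2) idx set_es by (fastforce simp: ms_def bs_def)
  qed
  show thesis
  proof (rule that[of "depth4 bs ms"])
    have "block_poly (bs ! idx e) = (\<Sum>q\<leftarrow>walk_block w xs l e. \<Prod>a\<leftarrow>q. label_poly a)"
      if "p \<in> set walks" "e \<in> set p" for p e
    proof -
      have "e \<in> set es" using that walks_props(2) set_es by blast
      then show ?thesis using idx[of e] by (simp add: bs_def block_poly_def)
    qed
    then have "(\<Sum>m\<leftarrow>ms. \<Prod>j\<leftarrow>m. block_poly (bs ! j))
      = (\<Sum>p\<leftarrow>walks. \<Prod>e\<leftarrow>p. \<Sum>q\<leftarrow>walk_block w xs l e. \<Prod>a\<leftarrow>q. label_poly a)"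
      unfolding ms_def by (simp add: comp_def cong: map_cong)
    then show "circuit_poly (depth4 bs ms) = mpow (set xs) (\<lambda>x y. label_poly (w x y)) (Suc k * Suc l) i j"
      by (simp only: walks_poly circuit_poly_depth4)
    have len: "length es = length xs ^ 2" by (simp add: es_def power2_eq_square)
    then show "num_add (depth4 bs ms) = length xs ^ 2 + 1" unfolding num_add_depth4 by (simp add: bs_def)
    have "length (concat bs) = length xs ^ 2 * length xs ^ l"
      using length_concat_map_const[of es "walk_block w xs l" "length xs ^ l"] walk_block_props(1)
      by (simp add: bs_def len)
    then show "num_mul (depth4 bs ms) = length xs ^ 2 * length xs ^ l + length xs ^ k"
      unfolding num_mul_depth4 by (simp add: ms_def walks_props(1))
    show "\<exists>x\<in>set xs. \<exists>y. a = w x y" if "a \<in> input_labels (depth4 bs ms)" for a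
    proof -
      have "a \<in> set (concat (concat bs))" using that by (simp only: input_labels_depth4)
      then obtain e q where "e \<in> set es" "q \<in> set (walk_block w xs l e)" "a \<in> set q"
        by (auto simp: bs_def)
      then show ?thesis using walk_block_props(3)[of e q a] set_es by auto
    qed
    show "fan_in g \<in> {Suc k, Suc l}" if "g \<in> set (gates (depth4 bs ms))" "is_mul g" for g
    proof -
      have q: "length q = Suc l" if "q \<in> set (concat bs)" for q
        using that walk_block_props(2) by (auto simp: bs_def)
      have m: "length m = Suc k" if "m \<in> set ms" for m
        using that walks_props(2) by (auto simp: ms_def)
      from fan_in_mul_depth4[OF that] show ?thesis
      proof (elim UnE imageE)
        fix q assume "fan_in g = length q" "q \<in> set (concat bs)"
        then show ?thesis by (simp only: q insert_iff simp_thms)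
      next
        fix m assume "fan_in g = length m" "m \<in> set ms"
        then show ?thesis by (simp only: m insert_iff simp_thms)
      qed
    qed
  qed (rule depth_four unweighted_depth4)+
qed

lemma depth_four_formula_of_mpow:
  obtains \<Gamma> where "depth_four_formula \<Gamma>"
    "circuit_poly \<Gamma> = mpow (set xs) (\<lambda>x y. label_poly (w x y)) (Suc k * Suc l) i j"
    "unweighted_adds \<Gamma>"
    "num_add \<Gamma> = Suc k * length xs ^ k + 1"
    "num_mul \<Gamma> = Suc k * length xs ^ k * length xs ^ l + length xs ^ k"
    "\<And>a. a \<in> input_labels \<Gamma> \<Longrightarrow> \<exists>x\<in>set xs. \<exists>y. a = w x y"
    "\<And>g. g \<in> set (gates \<Gamma>) \<Longrightarrow> is_mul g \<Longrightarrow> fan_in g \<in> {Suc k, Suc l}"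
proof -
  \<comment> \<open>Here every occurrence of an edge in a walk gets a block of its own, so that no
    fan-out exceeds one.\<close>
  define es where "es = concat walks"
  have set_es: "set es \<subseteq> set xs \<times> set xs" using walks_props(2) by (auto simp: es_def)
  define bs where "bs = map (walk_block w xs l) es"
  define ms where "ms = chunks 0 walks"
  have ms_len: "length m = Suc k" if "m \<in> set ms" for m
    using length_chunks_mem[of m 0 walks] walks_props(2) that by (auto simp: ms_def)
  have concat_ms: "concat ms = [0..<length bs]"
    by (simp add: ms_def bs_def es_def concat_chunks)
  interpret depth4_data bs ms
  proof
    show "[] \<notin> set (concat bs)" using walk_block_props(2) by (fastforce simp: bs_def)
    show "[] \<notin> set bs" using walk_block_nonempty[symmetric] by (auto simp: bs_def)
    show "[] \<notin> set ms" using ms_len by fastforce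
    have "length ms = length xs ^ k" by (simp add: ms_def walks_props(1))
    then show "ms \<noteq> []" using xs_nonempty by auto
    show "n < length bs" if "m \<in> set ms" "n \<in> set m" for m n
    proof -
      have "n \<in> set (concat ms)" using that by auto
      then show ?thesis unfolding concat_ms by simp
    qed
  qed
  show thesis
  proof (rule that[of "depth4 bs ms"])
    let ?f = "\<lambda>e. \<Sum>q\<leftarrow>walk_block w xs l e. \<Prod>a\<leftarrow>q. label_poly a"
    have "block_poly (bs ! n) = ?f (es ! n)" if "m \<in> set ms" "n \<in> set m" for m n
      using indices_less[OF that] by (simp add: bs_def block_poly_def)
    then have "circuit_poly (depth4 bs ms) = (\<Sum>m\<leftarrow>ms. \<Prod>n\<leftarrow>m. ?f (es ! n))"
      unfolding circuit_poly_depth4 by (simp cong: map_cong)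
    also have "\<dots> = (\<Sum>p\<leftarrow>map (map ((!) es)) ms. \<Prod>e\<leftarrow>p. ?f e)" by (simp add: comp_def)
    also have "map (map ((!) es)) ms = walks" using chunks_nth[of "[]" walks] by (simp add: ms_def es_def)
    finally show "circuit_poly (depth4 bs ms) = mpow (set xs) (\<lambda>x y. label_poly (w x y)) (Suc k * Suc l) i j"
      by (simp only: walks_poly)
    have len: "length es = Suc k * length xs ^ k"
      using length_concat_map_const[of walks "\<lambda>p. p" "Suc k"] walks_props by (simp add: es_def mult.commute)
    then show "num_add (depth4 bs ms) = Suc k * length xs ^ k + 1" unfolding num_add_depth4 by (simp add: bs_def)
    have "length (concat bs) = Suc k * length xs ^ k * length xs ^ l"
      using length_concat_map_const[of es "walk_block w xs l" "length xs ^ l"] walk_block_props(1)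
      by (simp add: bs_def len)
    then show "num_mul (depth4 bs ms) = Suc k * length xs ^ k * length xs ^ l + length xs ^ k"
      unfolding num_mul_depth4 by (simp add: ms_def walks_props(1))
    show "\<exists>x\<in>set xs. \<exists>y. a = w x y" if "a \<in> input_labels (depth4 bs ms)" for a
    proof -
      have "a \<in> set (concat (concat bs))" using that by (simp only: input_labels_depth4)
      then obtain e q where "e \<in> set es" "q \<in> set (walk_block w xs l e)" "a \<in> set q"
        by (auto simp: bs_def)
      then show ?thesis using walk_block_props(3)[of e q a] set_es by auto
    qed
    show "fan_in g \<in> {Suc k, Suc l}" if "g \<in> set (gates (depth4 bs ms))" "is_mul g" for g
    proof -
      have q: "length q = Suc l" if "q \<in> set (concat bs)" for q
        using that walk_block_props(2) by (auto simp: bs_def)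
      from fan_in_mul_depth4[OF that] show ?thesis
      proof (elim UnE imageE)
        fix q assume "fan_in g = length q" "q \<in> set (concat bs)"
        then show ?thesis by (simp only: q insert_iff simp_thms)
      next
        fix m assume "fan_in g = length m" "m \<in> set ms"
        then show ?thesis by (simp only: ms_len insert_iff simp_thms)
      qed
    qed
  qed (rule depth_four_formula[OF concat_ms] unweighted_depth4)+
qed

end

subsection \<open>Stacks of gates\<close>

text \<open>Compare with the binomial expansion, whose coefficients are at least 1.\<close>

lemma sum_powers_le: "(\<Sum>k\<le>m. u ^ k) \<le> (u + 1 :: nat) ^ m"
proof -
  have "u ^ k \<le> (m choose k) * u ^ k * 1 ^ (m - k)" if "k \<le> m" for k
    using that by (simp add: Suc_le_eq)
  then show ?thesis unfolding binomial by (intro sum_mono) simp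
qed

locale binary_circuit =
  fixes C :: "('v, 'k::field) circuit"
  assumes arithmetic: "arithmetic_circuit C" and binary: "binary_muls C"
begin

definition "gs = gates C"
definition "t = length gs"
definition "P i = gate_polys gs ! i"
definition "D i = gate_degrees gs ! i"
definition "d = D (out C)"

lemma out_less: "out C < t"
  using arithmetic by (simp add: arithmetic_circuit_def t_def gs_def)

lemma args_less: "i < t \<Longrightarrow> j \<in> set (args (gs ! i)) \<Longrightarrow> j < i"
  using arithmetic by (simp add: arithmetic_circuit_def t_def gs_def)

lemma fan_in_ge1: "i < t \<Longrightarrow> \<not> is_input (gs ! i) \<Longrightarrow> fan_in (gs ! i) \<ge> 1"
  using arithmetic nth_mem[of i gs] by (auto simp: arithmetic_circuit_def t_def gs_def)

lemma P_eq: "i < t \<Longrightarrow> P i = gate_poly (gate_polys gs) (gs ! i)"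
  unfolding P_def by (rule gate_polys_nth) (use args_less in \<open>auto simp: t_def\<close>)

lemma D_eq: "i < t \<Longrightarrow> D i = gate_degree (gate_degrees gs) (gs ! i)"
  unfolding D_def by (rule gate_degrees_nth) (use args_less in \<open>auto simp: t_def\<close>)

lemma input_gate:
  assumes "i < t" "gs ! i = Input l"
  shows "P i = label_poly l" "D i = 1"
  using assms by (simp_all add: P_eq D_eq)

lemma mul_gate:
  assumes "i < t" "gs ! i = Mul js"
  obtains x y where "js = [x, y]" "x < i" "y < i" "P i = P x * P y" "D i = D x + D y"
proof -
  have "Mul js \<in> set (gates C)" using assms by (metis gs_def nth_mem t_def)
  then have "length js = 2" using binary by (fastforce simp: binary_muls_def fan_in_def)
  then obtain x y where "js = [x, y]"
    by (auto simp: numeral_2_eq_2 length_Suc_conv)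
  moreover from this have "x < i" "y < i" using args_less[OF assms(1)] assms(2) by auto
  moreover have "P i = P x * P y" "D i = D x + D y"
    using P_eq[OF assms(1)] D_eq[OF assms(1)] assms(2) calculation by (simp_all add: P_def D_def)
  ultimately show thesis by (rule that)
qed

lemma add_gate:
  assumes "i < t" "gs ! i = Add ws"
  shows "P i = (\<Sum>(a, j)\<leftarrow>ws. mconst a * P j)" "D i = Max (D ` snd ` set ws)" "ws \<noteq> []"
    "\<And>a j. (a, j) \<in> set ws \<Longrightarrow> j < i \<and> D j \<le> D i"
proof -
  show "P i = (\<Sum>(a, j)\<leftarrow>ws. mconst a * P j)"
    using P_eq[OF assms(1)] assms(2) by (simp add: P_def)
  show D: "D i = Max (D ` snd ` set ws)"
    using D_eq[OF assms(1)] assms(2) by (simp add: D_def image_image case_prod_unfold)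
  show "ws \<noteq> []" using fan_in_ge1[OF assms(1)] assms(2) by (auto simp: fan_in_def)
  show "j < i \<and> D j \<le> D i" if "(a, j) \<in> set ws" for a j
  proof
    show "j < i" using args_less[OF assms(1)] assms(2) that by force
    show "D j \<le> D i" unfolding D using that by (intro Max_ge) force+
  qed
qed

text \<open>A multiplication at most doubles the largest bound among the earlier gates. The upper
  bound later forces \<open>t\<close> to be large enough, relative to \<open>d\<close>, for the
  numerical estimates.\<close>

lemma D_bounds: "i < t \<Longrightarrow> 1 \<le> D i \<and> D i \<le> 2 ^ i"
proof (induction i rule: less_induct)
  case (less i)
  show ?case
  proof (cases "gs ! i")
    case (Input l)
    then show ?thesis using input_gate less.prems by simp
  next
    case (Mul js)
    from less.prems this obtain x y where xy: "x < i" "y < i" "D i = D x + D y"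
      by (rule mul_gate)
    then obtain k where k: "i = Suc k" by (cases i) auto
    have "D x \<le> 2 ^ x" "D y \<le> 2 ^ y" "1 \<le> D x" using less xy by auto
    moreover have "(2::nat) ^ x \<le> 2 ^ k" "(2::nat) ^ y \<le> 2 ^ k" using xy k by simp_all
    ultimately have "1 \<le> D i" "D i \<le> 2 ^ k + 2 ^ k" using xy(3) by linarith+
    then show ?thesis using k by simp
  next
    case (Add ws)
    note ag = add_gate[OF less.prems Add]
    have "D i \<in> D ` snd ` set ws" unfolding ag(2) using ag(3) by (intro Max_in) auto
    then obtain a j where aj: "(a, j) \<in> set ws" "D i = D j" by auto
    then have "j < i" using ag(4) by blast
    moreover from this have "(2::nat) ^ j \<le> 2 ^ i" by simp
    ultimately show ?thesis using less.IH[of j] less.prems aj(2) by (auto intro: le_trans)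
  qed
qed

lemma d_pos: "1 \<le> d" and d_le: "d \<le> 2 ^ (t - 1)"
proof -
  show "1 \<le> d" using D_bounds out_less by (simp add: d_def)
  have "d \<le> 2 ^ out C" using D_bounds out_less by (simp add: d_def)
  also have "\<dots> \<le> 2 ^ (t - 1)" using out_less by (intro power_increasing) simp_all
  finally show "d \<le> 2 ^ (t - 1)" .
qed

section \<open>Expanding a gate over the non-addition gates\<close>

abbreviation "plain \<equiv> constant_free C \<and> ordinary_adds C"

definition small :: "'k \<Rightarrow> bool" where
  "small a \<longleftrightarrow> (\<exists>z :: int. a = of_int z \<and> \<bar>z\<bar> \<le> 2 ^ t)"

text \<open>Here \<open>c h\<close> is the sum, over all paths of addition gates from \<open>i\<close> down to the non-addition gate
  \<open>h\<close>, of the product of the weights along the path.\<close>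

definition collapse :: "nat \<Rightarrow> (nat \<Rightarrow> 'k) \<Rightarrow> bool" where
  "collapse i c \<longleftrightarrow>
     (\<forall>h. c h \<noteq> 0 \<longrightarrow> h < t \<and> \<not> is_add (gs ! h) \<and> D h \<le> D i) \<and>
     P i = (\<Sum>h<t. mconst (c h) * P h) \<and>
     (plain \<longrightarrow> (\<exists>z :: nat \<Rightarrow> int. (\<forall>h. c h = of_int (z h)) \<and> (\<Sum>h<t. \<bar>z h\<bar>) \<le> 2 ^ i))"

lemma collapse_self:
  assumes "i < t" "\<not> is_add (gs ! i)"
  shows "collapse i (\<lambda>h. of_bool (h = i))"
proof -
  have "P i = (\<Sum>h<t. if h = i then P h else 0)" using assms(1) by simp
  also have "\<dots> = (\<Sum>h<t. mconst (of_bool (h = i)) * P h)" by (intro sum.cong) auto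
  finally have "P i = \<dots>" .
  moreover have "(\<Sum>h<t. \<bar>of_bool (h = i)\<bar>) = (\<Sum>h<t. if h = i then 1 else 0 :: int)"
    by (intro sum.cong) auto
  then have "(\<Sum>h<t. \<bar>of_bool (h = i) :: int\<bar>) = 1" using assms(1) by simp
  then have "\<exists>z :: nat \<Rightarrow> int. (\<forall>h. of_bool (h = i) = (of_int (z h) :: 'k)) \<and> (\<Sum>h<t. \<bar>z h\<bar>) \<le> 2 ^ i"
    by (intro exI[of _ "\<lambda>h. of_bool (h = i)"]) simp
  ultimately show ?thesis using assms by (simp add: collapse_def)
qed

text \<open>Combine the expansions of the inputs of an addition gate linearly. In the ordinary case
  it has two inputs, of weight 1 or -1, so the sums of absolute values add up to at most
  \<open>2 ^ x + 2 ^ y\<close>, which is at most \<open>2 ^ i\<close> because \<open>x\<close> and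
  \<open>y\<close> are smaller than \<open>i\<close>.\<close>

lemma collapse_exists: "i < t \<Longrightarrow> \<exists>c. collapse i c"
proof (induction i rule: less_induct)
  case (less i)
  show ?case
  proof (cases "gs ! i")
    case (Add ws)
    note ag = add_gate[OF less.prems Add]
    have "\<forall>j. \<exists>c. j < i \<longrightarrow> collapse j c" using less by (meson dual_order.strict_trans)
    then obtain c where c: "\<And>j. j < i \<Longrightarrow> collapse j (c j)" by metis
    define e where "e h = (\<Sum>(a, j)\<leftarrow>ws. a * c j h)" for h
    have e_exp: "mconst (e h) = (\<Sum>(a, j)\<leftarrow>ws. mconst a * mconst (c j h))" for h
      unfolding e_def by (induction ws) auto
    have supp: "h < t \<and> \<not> is_add (gs ! h) \<and> D h \<le> D i" if "e h \<noteq> 0" for h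
    proof -
      have "\<exists>(a, j) \<in> set ws. a * c j h \<noteq> 0"
      proof (rule ccontr)
        assume "\<not> ?thesis"
        then have "map (\<lambda>(a, j). a * c j h) ws = map (\<lambda>_. 0) ws" by auto
        then have "e h = sum_list (map (\<lambda>_. 0) ws)" unfolding e_def by (rule arg_cong)
        then have "e h = 0" by simp
        with that show False by simp
      qed
      then obtain a j where aj: "(a, j) \<in> set ws" "c j h \<noteq> 0" by auto
      with ag(4) have "j < i" "D j \<le> D i" by blast+
      with c aj(2) show ?thesis unfolding collapse_def by (meson le_trans)
    qed
    have "P i = (\<Sum>(a, j)\<leftarrow>ws. mconst a * (\<Sum>h<t. mconst (c j h) * P h))"
    proof -
      have "P j = (\<Sum>h<t. mconst (c j h) * P h)" if "(a, j) \<in> set ws" for a j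
        using c ag(4)[OF that] by (simp add: collapse_def)
      then have "map (\<lambda>(a, j). mconst a * P j) ws
        = map (\<lambda>(a, j). mconst a * (\<Sum>h<t. mconst (c j h) * P h)) ws" by (intro map_cong) auto
      then show ?thesis unfolding ag(1) by (rule arg_cong)
    qed
    also have "\<dots> = (\<Sum>(a, j)\<leftarrow>ws. \<Sum>h<t. mconst a * mconst (c j h) * P h)"
      by (simp add: sum_distrib_left mult.assoc)
    also have "\<dots> = (\<Sum>h<t. mconst (e h) * P h)"
      unfolding case_prod_unfold e_exp sum_list_sum_swap by (simp add: sum_list_mult_const)
    finally have val: "P i = (\<Sum>h<t. mconst (e h) * P h)" .
    have "\<exists>z :: nat \<Rightarrow> int. (\<forall>h. e h = of_int (z h)) \<and> (\<Sum>h<t. \<bar>z h\<bar>) \<le> 2 ^ i" if pl: plain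
    proof -
      have "Add ws \<in> set (gates C)" using less.prems Add by (metis gs_def nth_mem t_def)
      then obtain x y where "ws = [(1, x), (1, y)] \<or> ws = [(1, x), (-1, y)]"
        using pl unfolding ordinary_adds_def by blast
      \<comment> \<open>The sign \<open>s\<close> treats addition and subtraction at once.\<close>
      then have "\<exists>s :: int. ws = [(1, x), (of_int s, y)] \<and> \<bar>s\<bar> = 1"
        by (auto intro: exI[of _ 1] exI[of _ "-1"])
      then obtain s :: int where ws: "ws = [(1, x), (of_int s, y)]" and s: "\<bar>s\<bar> = 1" by blast
      have xy: "x < i" "y < i" using ag(4) ws by auto
      then obtain zx zy :: "nat \<Rightarrow> int" where z:
        "\<And>h. c x h = of_int (zx h)" "(\<Sum>h<t. \<bar>zx h\<bar>) \<le> 2 ^ x"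
        "\<And>h. c y h = of_int (zy h)" "(\<Sum>h<t. \<bar>zy h\<bar>) \<le> 2 ^ y"
        using c pl unfolding collapse_def by meson
      obtain k where k: "i = Suc k" using xy by (cases i) auto
      have "(\<Sum>h<t. \<bar>zx h + s * zy h\<bar>) \<le> (\<Sum>h<t. \<bar>zx h\<bar> + \<bar>zy h\<bar>)"
        using s by (intro sum_mono order_trans[OF abs_triangle_ineq]) (simp add: abs_mult)
      also have "\<dots> \<le> 2 ^ x + 2 ^ y" using z by (simp add: sum.distrib)
      also have "\<dots> \<le> 2 ^ k + 2 ^ k" using xy k by (intro add_mono power_increasing) simp_all
      finally have "(\<Sum>h<t. \<bar>zx h + s * zy h\<bar>) \<le> 2 ^ i" using k by simp
      moreover have "e h = of_int (zx h + s * zy h)" for h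
        by (simp add: e_def ws z)
      ultimately show ?thesis by (intro exI[of _ "\<lambda>h. zx h + s * zy h"]) simp
    qed
    with supp val have "collapse i e" unfolding collapse_def by blast
    then show ?thesis by blast
  qed (use collapse_self[of i] less.prems in auto)
qed

text \<open>Any expansion serves, even for a multiplication gate, whose chosen expansion may differ
  from the gate itself: progress is measured by degrees, and \<open>collapse\<close> guarantees
  \<open>D h \<le> D g\<close>.\<close>

definition wt :: "nat \<Rightarrow> nat \<Rightarrow> 'k" where
  "wt i = (SOME c. collapse i c)"

lemma collapse_wt: "i < t \<Longrightarrow> collapse i (wt i)"
  unfolding wt_def using collapse_exists by (rule someI_ex)

section \<open>Counting the stacks\<close>

fun chain :: "nat \<Rightarrow> nat list \<Rightarrow> bool" where
  "chain s [] \<longleftrightarrow> s \<le> d"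
| "chain s (g # R) \<longleftrightarrow> s \<le> D g \<and> chain (s + D g) R"

lemma chain_mono: "chain s R \<Longrightarrow> s' \<le> s \<Longrightarrow> chain s' R"
proof (induction R arbitrary: s s')
  case (Cons g R)
  then show ?case using Cons.IH[of "s + D g" "s' + D g"] by simp
qed simp

text \<open>\<open>s\<close> is the total degree of the entries nearer to the top. Every further
  entry is at least as large as this total, so the total doubles each time and still ends at most at
  \<open>d\<close>.\<close>

lemma chain_pow: "chain s R \<Longrightarrow> s * 2 ^ length R \<le> d"
proof (induction R arbitrary: s)
  case (Cons g R)
  then have "(s + D g) * 2 ^ length R \<le> d" by simp
  moreover have "(s + s) * 2 ^ length R \<le> (s + D g) * 2 ^ length R"
    using Cons.prems by (intro mult_right_mono) simp_all
  ultimately have "(s + s) * 2 ^ length R \<le> d" by (rule order_trans[rotated])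
  then show ?case by (simp add: algebra_simps)
qed simp

lemma chain_sum: "chain s R \<Longrightarrow> s + (\<Sum>g\<leftarrow>R. D g) \<le> d"
  by (induction R arbitrary: s) fastforce+

definition states :: "nat list set" where
  "states = {S. set S \<subseteq> {..<t} \<and> chain 0 S}"

text \<open>The top entry has degree at least 1 and the total doubles below it, which bounds the
  height. The output alone has degree \<open>d\<close> and uses up the whole budget, so it shares a
  stack with no other gate of positive degree; separating it leaves lists over \<open>t - 1\<close>
  gates.\<close>

lemma states_subset:
  assumes "d < 2 ^ m"
  shows "states \<subseteq> insert [out C] {S. set S \<subseteq> {..<t} - {out C} \<and> length S \<le> m}"
proof
  fix S assume S: "S \<in> states"
  then have sub: "set S \<subseteq> {..<t}" and ch: "chain 0 S" by (auto simp: states_def)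
  have "length S \<le> m"
  proof (cases S)
    case (Cons g R)
    then have "D g * 2 ^ length R \<le> d" using ch chain_pow[of "D g" R] by simp
    moreover have "1 \<le> D g" using Cons sub D_bounds by simp
    then have "2 ^ length R \<le> D g * 2 ^ length R" by simp
    ultimately have "(2::nat) ^ length R < 2 ^ m" using assms by linarith
    then show ?thesis using Cons by simp
  qed simp
  moreover have "S = [out C]" if out: "out C \<in> set S"
  proof -
    obtain us vs where S': "S = us @ out C # vs" using split_list[OF out] by blast
    have "D g \<noteq> 0" if "g \<in> set us \<union> set vs" for g
      using that sub D_bounds[of g] by (auto simp: S')
    moreover have "(\<Sum>g\<leftarrow>us. D g) = 0" "(\<Sum>g\<leftarrow>vs. D g) = 0"
      using chain_sum[OF ch] by (simp_all add: S' d_def)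
    ultimately have "us = []" "vs = []" by (cases us; cases vs; simp)+
    then show ?thesis by (simp add: S')
  qed
  ultimately show "S \<in> insert [out C] {S. set S \<subseteq> {..<t} - {out C} \<and> length S \<le> m}"
    using sub by auto
qed

lemma states_card:
  assumes "d < 2 ^ m"
  shows "finite states" "card states \<le> t ^ m + 1"
proof -
  let ?A = "{S. set S \<subseteq> {..<t} - {out C} \<and> length S \<le> m}"
  have fin: "finite ?A" by (rule finite_lists_length_le) simp
  then show "finite states" using states_subset[OF assms] by (metis finite_insert finite_subset)
  have "card states \<le> card (insert [out C] ?A)"
    using states_subset[OF assms] fin by (intro card_mono) simp_all
  also have "\<dots> \<le> Suc (card ?A)" by (rule card_insert_le_m1) simp_all
  also have "card ?A = (\<Sum>k\<le>m. (t - 1) ^ k)"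
    using out_less by (subst card_lists_length_le) simp_all
  also have "\<dots> \<le> t ^ m" using sum_powers_le[of "t - 1" m] out_less by simp
  finally show "card states \<le> t ^ m + 1" by simp
qed

section \<open>The transition matrix on stacks\<close>

text \<open>The factor of smaller degree goes on top: each further stack entry then at least doubles the
  total degree, which is what \<open>chain\<close> records and what bounds the height of the stack.\<close>

definition after :: "nat \<Rightarrow> nat list \<Rightarrow> nat list" where
  "after h R =
     (case gs ! h of
        Mul [x, y] \<Rightarrow> if D x \<le> D y then x # y # R else y # x # R
      | _ \<Rightarrow> h # R)"

text \<open>Different \<open>h\<close> may lead to the same stack, for instance two products of the
  same gates. Their weights are summed so that the entry remains a single constant.\<close>

fun step :: "nat list \<Rightarrow> nat list \<Rightarrow> ('v, 'k) label" where
  "step [] S' = Const (of_bool (S' = []))"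
| "step (g # R) S' =
     (case gs ! g of
        Input l \<Rightarrow> if S' = R then l else Const 0
      | _ \<Rightarrow> Const (\<Sum>h | h < t \<and> wt g h \<noteq> 0 \<and> after h R = S'. wt g h))"

definition val :: "nat list \<Rightarrow> ('v, 'k) mpoly" where
  "val S = (\<Prod>g\<leftarrow>S. P g)"

text \<open>A parse tree with \<open>D g\<close> leaves has \<open>2 * D g - 1\<close> nodes. Each leaf contributes one factor and
  each node, reached through addition gates, one weight.\<close>

definition cost :: "nat \<Rightarrow> nat" where
  "cost g = (if is_input (gs ! g) then 1 else 3 * D g - 1)"

definition potential :: "nat list \<Rightarrow> nat" where
  "potential S = (\<Sum>g\<leftarrow>S. cost g)"

lemma cost_bounds: "g < t \<Longrightarrow> 1 \<le> cost g \<and> cost g \<le> 3 * D g - 1"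
  using D_bounds[of g] by (auto simp: cost_def)

text \<open>The chain condition survives because the smaller factor precedes the larger and both
  together have degree \<open>D h\<close>. The potential drops strictly: two factors cost at most
  \<open>(3 * D x - 1) + (3 * D y - 1) = 3 * D h - 2\<close>, and an input costs 1, which is less
  than \<open>3 * 1 - 1\<close>.\<close>

lemma after_props:
  assumes h: "h < t" "\<not> is_add (gs ! h)"
  shows "val (after h R) = P h * val R"
    and "set (after h R) \<subseteq> {..<t} \<union> set R"
    and "chain (D h) R \<Longrightarrow> chain 0 (after h R)"
    and "potential (after h R) < 3 * D h - 1 + potential R"
proof -
  consider l where "gs ! h = Input l"
    | x y where "gs ! h = Mul [x, y]" "x < h" "y < h" "P h = P x * P y" "D h = D x + D y"
  proof (cases "gs ! h")
    case (Mul js)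
    with h(1) show ?thesis by (rule mul_gate) (use Mul that(2) in simp)
  qed (use h that in auto)
  note cs = this
  have "val (after h R) = P h * val R \<and> set (after h R) \<subseteq> {..<t} \<union> set R \<and>
    (chain (D h) R \<longrightarrow> chain 0 (after h R)) \<and> potential (after h R) < 3 * D h - 1 + potential R"
    (is "?A \<and> ?B \<and> (?C \<longrightarrow> ?C') \<and> ?E")
    using cs
  proof cases
    case 1
    then show ?thesis using h input_gate[of h l]
      by (auto simp: after_def val_def potential_def cost_def)
  next
    case 2
    have "cost x + cost y < 3 * D h - 1"
      using cost_bounds[of x] cost_bounds[of y] 2 h D_bounds[of x] D_bounds[of y] by linarith
    with 2 h show ?thesis
      by (auto simp: after_def val_def potential_def ac_simps)
  qed
  then show ?A ?B "?C \<Longrightarrow> ?C'" ?E by (elim conjE, assumption | iprover)+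
qed

lemma wt_props:
  assumes "g < t" "wt g h \<noteq> 0"
  shows "h < t" "\<not> is_add (gs ! h)" "D h \<le> D g"
  using collapse_wt[OF assms(1)] assms(2) by (auto simp: collapse_def)

lemma step_noninput:
  assumes "\<not> is_input (gs ! g)"
  shows "step (g # R) S' = Const (\<Sum>h | h < t \<and> wt g h \<noteq> 0 \<and> after h R = S'. wt g h)"
  using assms by (cases "gs ! g") simp_all

lemma states_Cons:
  assumes "g # R \<in> states"
  shows "g < t" "chain (D g) R" "R \<in> states" "set R \<subseteq> {..<t}"
  using assms chain_mono[of "D g" R 0] by (auto simp: states_def)

lemma after_states:
  assumes "g # R \<in> states" "wt g h \<noteq> 0"
  shows "after h R \<in> states"
proof -
  note g = states_Cons[OF assms(1)] and h = wt_props[OF states_Cons(1)[OF assms(1)] assms(2)]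
  have "chain (D h) R" using chain_mono[OF g(2) h(3)] .
  then show ?thesis using after_props(2,3)[OF h(1,2), of R] g(4) by (auto simp: states_def)
qed

lemma finite_states: "finite states"
  using states_card(1)[of d] by (simp add: less_exp)

text \<open>\<open>val\<close> is a fixed vector of the matrix: expand the top gate over
  non-addition gates and multiply by the rest of the stack. At the empty stack and at an input gate
  only one transition remains.\<close>

lemma val_step:
  assumes "S \<in> states"
  shows "val S = (\<Sum>S'\<in>states. label_poly (step S S') * val S')"
proof (cases S)
  case Nil
  have "(\<Sum>S'\<in>states. label_poly (step S S') * val S') = (\<Sum>S'\<in>states. if S' = [] then val S' else 0)"
    by (intro sum.cong) (auto simp: Nil)
  then show ?thesis using assms finite_states Nil by simp
next
  case (Cons g R)
  note g = states_Cons[OF assms[unfolded Cons]]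
  show ?thesis
  proof (cases "is_input (gs ! g)")
    case True
    then obtain l where l: "gs ! g = Input l" by (cases "gs ! g") auto
    have "(\<Sum>S'\<in>states. label_poly (step S S') * val S')
      = (\<Sum>S'\<in>states. if S' = R then label_poly l * val S' else 0)"
      by (intro sum.cong) (auto simp: Cons l)
    then show ?thesis using g finite_states input_gate(1)[OF g(1) l] by (simp add: val_def Cons)
  next
    case False
    define H where "H = {h. h < t \<and> wt g h \<noteq> 0}"
    have H: "finite H" by (simp add: H_def)
    have "P g = (\<Sum>h<t. mconst (wt g h) * P h)"
      using collapse_wt[OF g(1)] by (simp add: collapse_def)
    also have "\<dots> = (\<Sum>h\<in>H. mconst (wt g h) * P h)"
      by (rule sum.mono_neutral_right) (auto simp: H_def)
    finally have "val S = (\<Sum>h\<in>H. mconst (wt g h) * (P h * val R))"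
      by (simp add: Cons val_def sum_distrib_right mult.assoc)
    also have "\<dots> = (\<Sum>h\<in>H. mconst (wt g h) * val (after h R))"
      using after_props(1) wt_props[OF g(1)] by (intro sum.cong) (simp_all add: H_def)
    \<comment> \<open>Group the summands by the stack they lead to; all these stacks are states by
      \<open>after_states\<close>.\<close>
    also have "\<dots> = (\<Sum>S'\<in>states. \<Sum>h | h \<in> H \<and> after h R = S'. mconst (wt g h) * val (after h R))"
      using after_states[OF assms[unfolded Cons]] H finite_states
      by (intro sum.group[symmetric]) (auto simp: H_def)
    also have "\<dots> = (\<Sum>S'\<in>states. label_poly (step S S') * val S')"
    proof (intro sum.cong refl)
      fix S'
      have "step S S' = Const (\<Sum>h | h \<in> H \<and> after h R = S'. wt g h)"
        using step_noninput[OF False] by (simp add: Cons H_def conj_assoc)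
      then show "(\<Sum>h | h \<in> H \<and> after h R = S'. mconst (wt g h) * val (after h R)) =
          label_poly (step S S') * val S'"
        by (simp add: mconst_sum sum_distrib_right)
    qed
    finally show ?thesis .
  qed
qed

lemma step_potential:
  assumes "S \<in> states" "label_poly (step S S') \<noteq> 0"
  shows "potential S' \<le> potential S - 1"
proof (cases S)
  case Nil
  then show ?thesis using assms(2) by (cases "S' = []") (simp_all add: potential_def)
next
  case (Cons g R)
  note g = states_Cons[OF assms(1)[unfolded Cons]]
  show ?thesis
  proof (cases "is_input (gs ! g)")
    case True
    then obtain l where l: "gs ! g = Input l" by (cases "gs ! g") auto
    then show ?thesis using assms(2) by (simp add: Cons potential_def cost_def split: if_splits)
  next
    case False
    have "(\<Sum>h | h < t \<and> wt g h \<noteq> 0 \<and> after h R = S'. wt g h) \<noteq> 0"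
      using assms(2) step_noninput[OF False, of R S'] by (auto simp: Cons)
    then obtain h where h: "wt g h \<noteq> 0" "after h R = S'"
      by (rule sum.not_neutral_contains_not_neutral) auto
    note hp = wt_props[OF g(1) h(1)]
    have "potential S' < 3 * D h - 1 + potential R" using after_props(4)[OF hp(1,2)] h(2) by blast
    also have "\<dots> \<le> potential S" using False hp(3) by (simp add: Cons potential_def cost_def)
    finally show ?thesis by simp
  qed
qed

lemma potential_eq_0:
  assumes "S \<in> states" "potential S = 0"
  shows "S = []"
proof (cases S)
  case (Cons g R)
  then show ?thesis using assms cost_bounds[of g] by (simp add: states_def potential_def)
qed simp

lemma init_state: "[out C] \<in> states" and final_state: "[] \<in> states"
  using out_less by (simp_all add: states_def d_def)

lemma circuit_poly_eq_mpow:
  assumes "3 * d - 1 \<le> k"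
  shows "circuit_poly C = mpow states (\<lambda>S S'. label_poly (step S S')) k [out C] []"
proof -
  have "circuit_poly C = val [out C]" by (simp add: circuit_poly_def val_def P_def gs_def)
  also have "\<dots> = mpow states (\<lambda>S S'. label_poly (step S S')) k [out C] []"
  proof (rule fixed_vector_eq_mpow[where \<mu> = potential])
    show "potential [out C] \<le> k"
      using cost_bounds[OF out_less] assms by (simp add: potential_def d_def)
  qed (use val_step step_potential potential_eq_0 init_state in \<open>auto simp: val_def\<close>)
  finally show ?thesis .
qed

lemma step_label: "S \<in> states \<Longrightarrow> step S S' \<in> input_labels C \<or> (\<exists>c. step S S' = Const c)"
proof (cases S)
  case (Cons g R)
  assume "S \<in> states"
  then have mem: "gs ! g \<in> set (gates C)" using states_Cons(1) by (simp add: Cons gs_def t_def)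
  show ?thesis by (cases "gs ! g") (use mem in \<open>auto simp: Cons input_labels_def\<close>)
qed simp

lemma small_const: "small 0" "small 1" "small (-1)"
proof -
  have "small (of_int z)" if "\<bar>z\<bar> \<le> 1" for z
    unfolding small_def using order_trans[OF that one_le_power[of "2 :: int" t]] by auto
  from this[of 0] this[of 1] this[of "-1"] show "small 0" "small 1" "small (-1)" by simp_all
qed

text \<open>A constant of the matrix may be a sum of several weights. This is why
  \<open>collapse\<close> bounds the sum of all absolute values and not each weight separately: the
  bound passes to every partial sum.\<close>

lemma step_small:
  assumes "S \<in> states" plain "step S S' = Const c"
  shows "small c"
proof (cases S)
  case Nil
  then show ?thesis using assms(3) small_const by (cases "S' = []") auto
next
  case (Cons g R)
  note g = states_Cons[OF assms(1)[unfolded Cons]]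
  show ?thesis
  proof (cases "is_input (gs ! g)")
    case True
    then obtain l where l: "gs ! g = Input l" by (cases "gs ! g") auto
    then have "Input l \<in> set (gates C)" using g(1) by (metis gs_def nth_mem t_def)
    then have "l \<in> input_labels C" by (simp add: input_labels_def)
    then show ?thesis using l assms(2,3) small_const
      by (auto simp: Cons constant_free_def split: if_splits)
  next
    case False
    let ?H = "{h. h < t \<and> wt g h \<noteq> 0 \<and> after h R = S'}"
    obtain z :: "nat \<Rightarrow> int" where z: "\<And>h. wt g h = of_int (z h)" "(\<Sum>h<t. \<bar>z h\<bar>) \<le> 2 ^ g"
      using collapse_wt[OF g(1)] assms(2) unfolding collapse_def by blast
    have "c = of_int (\<Sum>h\<in>?H. z h)"
      using assms(3) step_noninput[OF False, of R S'] z(1) by (simp add: Cons)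
    moreover have "\<bar>\<Sum>h\<in>?H. z h\<bar> \<le> (\<Sum>h\<in>?H. \<bar>z h\<bar>)" by (rule sum_abs)
    moreover have "(\<Sum>h\<in>?H. \<bar>z h\<bar>) \<le> (\<Sum>h<t. \<bar>z h\<bar>)" by (rule sum_mono2) auto
    moreover have "(2::int) ^ g \<le> 2 ^ t" using g(1) by simp
    ultimately show ?thesis using z(2) unfolding small_def by (intro exI[of _ "\<Sum>h\<in>?H. z h"]) linarith
  qed
qed

end

subsection \<open>Numerical estimates\<close>

text \<open>Exchanging base and exponent turns the right-hand side into
  \<open>(2 * d) powr log 2 t\<close>. The bound on \<open>d\<close> forces \<open>t \<ge> 2\<close>
  in the first case and \<open>t \<ge> 3\<close> in the second, hence exponents of at least 1 and
  3/2.\<close>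

lemma powr_log2_ge:
  fixes t d :: nat
  assumes "d \<ge> 1" "d \<le> 2 ^ (t - 1)"
  shows "d \<ge> 2 \<Longrightarrow> 2 * real d \<le> real t powr log 2 (2 * real d)"
    and "d \<ge> 3 \<Longrightarrow> 4 * real d \<le> real t powr log 2 (2 * real d)"
proof -
  have t2: "t \<ge> 2" if "d \<ge> 2"
    using that assms(2) by (cases "t \<le> 1") auto
  have t3: "t \<ge> 3" if "d \<ge> 3"
  proof (rule ccontr)
    assume "\<not> t \<ge> 3"
    then have "(2::nat) ^ (t - 1) \<le> 2 ^ 1" by (intro power_increasing) auto
    with that assms(2) show False by simp
  qed
  have swap: "real t powr log 2 (2 * real d) = (2 * real d) powr log 2 (real t)" if "t \<ge> 2"
    using that assms(1) by (simp add: powr_def log_def)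
  show "2 * real d \<le> real t powr log 2 (2 * real d)" if "d \<ge> 2"
  proof -
    have "(2 * real d) powr 1 \<le> (2 * real d) powr log 2 (real t)"
      using t2[OF that] that by (intro powr_mono) simp_all
    then show ?thesis using swap[OF t2[OF that]] that by simp
  qed
  show "4 * real d \<le> real t powr log 2 (2 * real d)" if "d \<ge> 3"
  proof -
    \<comment> \<open>This shows \<open>3 / 2 \<le> log 2 3\<close>, from
      \<open>sqrt 2 \<le> 3 / 2\<close>.\<close>
    have "2 powr (3 / 2) = 2 * sqrt (2 :: real)"
      using powr_add[of "2 :: real" 1 "1 / 2"] by (simp add: powr_half_sqrt)
    also have "sqrt (2 :: real) \<le> 3 / 2" by (rule real_le_lsqrt) (simp_all add: power2_eq_square)
    also have "2 * (3 / 2) \<le> real t" using t3[OF that] by simp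
    finally have "3 / 2 \<le> log 2 (real t)" using t3[OF that] by (subst le_log_iff) simp_all
    then have "(2 * real d) powr (3 / 2) \<le> real t powr log 2 (2 * real d)"
      using that t3[OF that] by (subst swap) (auto intro!: powr_mono)
    moreover have "(2 * real d) powr (3 / 2) = 2 * real d * sqrt (2 * real d)"
      using that powr_add[of "2 * real d" 1 "1 / 2"] by (simp add: powr_half_sqrt)
    moreover have "2 \<le> sqrt (2 * real d)" using that by (intro real_le_rsqrt) simp
    then have "2 * real d * 2 \<le> 2 * real d * sqrt (2 * real d)" by (intro mult_left_mono) simp_all
    ultimately show ?thesis by linarith
  qed
qed

text \<open>With \<open>q\<close> the integer part of \<open>sqrt (3 * d)\<close>, cut into \<open>q\<close> blocks of length \<open>q + 1\<close> if they
  suffice; otherwise \<open>sqrt (3 * d)\<close> is at least \<open>q + 1/2\<close>, which leaves room for the factor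
  \<open>q + 1\<close> counting the blocks of a formula.\<close>

lemma block_lengths:
  fixes t d :: nat
  assumes d: "d \<ge> 1" "d \<le> 2 ^ (t - 1)"
  defines "s \<equiv> real t powr log 2 (2 * real d) + 1"
  obtains k l where "3 * d - 1 \<le> Suc k * Suc l" "real k \<le> sqrt (3 * real d)" "real l \<le> sqrt (3 * real d)"
    "real (Suc k) * s ^ k \<le> s powr sqrt (3 * real d)"
proof -
  define r where "r = sqrt (3 * real d)"
  have r2: "r\<^sup>2 = real (3 * d)" by (simp add: r_def)
  have r0: "r \<ge> 0" by (simp add: r_def)
  have s1: "s \<ge> 1" by (simp add: s_def)
  define q where "q = nat \<lfloor>r\<rfloor>"
  have q: "real q \<le> r" "r < real q + 1" using r0 by (simp_all add: q_def)
  have "real (q\<^sup>2) \<le> real (3 * d)" using power_mono[OF q(1), of 2] r2 by simp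
  then have q2: "q\<^sup>2 \<le> 3 * d" by (simp only: of_nat_le_iff)
  have "real (3 * d) < real ((q + 1)\<^sup>2)" using power_strict_mono[OF q(2) r0, of 2] r2 by (simp add: add.commute)
  then have q3: "3 * d < (q + 1)\<^sup>2" by (simp only: of_nat_less_iff)
  have q_pos: "q \<ge> 1"
  proof (rule ccontr)
    assume "\<not> q \<ge> 1"
    then have "q = 0" by simp
    then have "3 * d < 1" using q3 by simp
    with d show False by simp
  qed
  show thesis
  proof (cases "3 * d - 1 \<le> q * (q + 1)")
    case True
    \<comment> \<open>For \<open>d = 1\<close> the circuit may have a single gate, and then
      \<open>2 * d \<le> t powr log 2 (2 * d)\<close> fails; but there \<open>q\<close> is
      1.\<close>
    have "real q \<le> s"
    proof (cases "d = 1")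
      case True
      then have "q < 2" using q2 by (intro power_less_imp_less_base[of q 2 2]) simp_all
      then show ?thesis using s1 by simp
    next
      case False
      then have d2: "d \<ge> 2" using d by simp
      have "3 * d \<le> 4 * (d * d)" by (cases d) simp_all
      also have "\<dots> = (2 * d)\<^sup>2" by (simp add: power2_eq_square)
      finally have "q\<^sup>2 \<le> (2 * d)\<^sup>2" using q2 by (rule order_trans[rotated])
      then have "q \<le> 2 * d" by (rule power2_le_imp_le) simp
      then show ?thesis using powr_log2_ge(1)[OF d d2] by (simp add: s_def)
    qed
    then have "real (Suc (q - 1)) * s ^ (q - 1) \<le> s * s ^ (q - 1)"
      using q_pos s1 by (intro mult_right_mono) simp_all
    also have "\<dots> = s powr real q" using q_pos s1 by (simp add: powr_realpow power_eq_if)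
    also have "\<dots> \<le> s powr r" using q s1 by (intro powr_mono) simp_all
    finally show ?thesis
      using that[of "q - 1" q] True q q_pos by (simp add: r_def)
  next
    case False
    then have ge: "q\<^sup>2 + q + 2 \<le> 3 * d" by (simp add: power2_eq_square)
    have d3: "d \<ge> 3"
    proof (rule ccontr)
      assume "\<not> d \<ge> 3"
      then have "q\<^sup>2 + q \<le> 4" using ge by simp
      moreover have "2 * 2 \<le> q * q" if "q \<ge> 2" using that by (intro mult_le_mono)
      ultimately have "q = 1" using q_pos by (cases "q \<ge> 2") (auto simp: power2_eq_square)
      with q3 ge show False by (simp add: power2_eq_square)
    qed
    have "q\<^sup>2 \<le> d\<^sup>2" using le_trans[OF q2 mult_le_mono1[OF d3]] by (simp only: power2_eq_square)
    then have "q \<le> d" by (rule power2_le_imp_le) simp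
    moreover have "(q + 1)\<^sup>2 = q\<^sup>2 + 2 * q + 1" by (simp add: power2_eq_square)
    \<comment> \<open>Write the square as \<open>(q^2 + q + 2) + (q - 1)\<close>: the first part is
      at most \<open>3 * d\<close>, the second at most \<open>d\<close>.\<close>
    ultimately have "(q + 1)\<^sup>2 \<le> 4 * d" using ge by linarith
    then have "real ((q + 1)\<^sup>2) \<le> real (4 * d)" by (simp only: of_nat_le_iff)
    also have "\<dots> \<le> s" using powr_log2_ge(2)[OF d d3] by (simp add: s_def)
    finally have "real (q + 1) \<le> sqrt s" by (intro real_le_rsqrt) simp
    then have "real (Suc q) * s ^ q \<le> s powr (1 / 2) * s powr real q"
      using s1 by (intro mult_mono) (simp_all add: powr_half_sqrt powr_realpow)
    also have "\<dots> = s powr (1 / 2 + real q)" by (simp add: powr_add)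
    also have "\<dots> \<le> s powr r"
    proof (intro powr_mono)
      have "(1 / 2 + real q)\<^sup>2 \<le> real (q\<^sup>2 + q + 2)" by (simp add: power2_eq_square algebra_simps)
      also have "\<dots> \<le> 3 * real d" using ge by linarith
      finally show "1 / 2 + real q \<le> r" unfolding r_def by (intro real_le_rsqrt)
    qed (use s1 in simp)
    finally have "real (Suc q) * s ^ q \<le> s powr r" .
    moreover have "3 * d - 1 \<le> Suc q * Suc q" using q3 by (simp add: power2_eq_square)
    ultimately show ?thesis using that[of q q] q by (simp add: r_def)
  qed
qed

section \<open>Assembly and gate counts\<close>

theorem theorem3:
  fixes C :: "('v, 'k::field) circuit" and t d :: nat
  assumes "arithmetic_circuit C"
    and "binary_muls C"
    and "circuit_size C = t"
    and "formal_degree C = d"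
  shows "\<exists>\<Gamma> \<Gamma>f :: ('v, 'k) circuit.
    depth_four_circuit \<Gamma> \<and> circuit_poly \<Gamma> = circuit_poly C \<and> unweighted_adds \<Gamma> \<and>
    real (num_add \<Gamma>) \<le> (real t powr log 2 (2 * real d) + 1) ^ 2 + 1 \<and>
    real (num_mul \<Gamma>) \<le> 2 * (real t powr log 2 (2 * real d) + 1) powr (sqrt (3 * real d) + 2) \<and>
    depth_four_formula \<Gamma>f \<and> circuit_poly \<Gamma>f = circuit_poly C \<and> unweighted_adds \<Gamma>f \<and>
    real (num_add \<Gamma>f) \<le> (real t powr log 2 (2 * real d) + 1) powr sqrt (3 * real d) + 1 \<and>
    real (num_mul \<Gamma>f) \<le> 2 * (real t powr log 2 (2 * real d) + 1) powr (2 * sqrt (3 * real d)) \<and>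
    (\<forall>l \<in> input_labels \<Gamma> \<union> input_labels \<Gamma>f. l \<in> input_labels C \<or> (\<exists>c. l = Const c)) \<and>
    (\<forall>g \<in> set (gates \<Gamma>) \<union> set (gates \<Gamma>f). is_mul g \<longrightarrow> real (fan_in g) \<le> sqrt (3 * real d) + 1) \<and>
    (constant_free C \<and> ordinary_adds C \<longrightarrow>
       (\<forall>c. Const c \<in> input_labels \<Gamma> \<union> input_labels \<Gamma>f \<longrightarrow>
          (\<exists>z :: int. c = of_int z \<and> \<bar>z\<bar> \<le> 2 ^ t)))"
proof -
  interpret BC: binary_circuit C using assms(1,2) by unfold_locales
  have t: "BC.t = t" using assms(3) by (simp add: BC.t_def BC.gs_def circuit_size_def)
  have d: "BC.d = d" using assms(4) by (simp add: BC.d_def BC.D_def BC.gs_def formal_degree_def)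
  have d_pos: "d \<ge> 1" and d_le: "d \<le> 2 ^ (t - 1)" using BC.d_pos BC.d_le by (simp_all add: t d)
  have t_pos: "t \<ge> 1" using BC.out_less by (simp add: t)
  define r where "r = sqrt (3 * real d)"
  define s where "s = real t powr log 2 (2 * real d) + 1"
  have s1: "s \<ge> 1" by (simp add: s_def)
  obtain k l where kl: "3 * d - 1 \<le> Suc k * Suc l" "real k \<le> r" "real l \<le> r"
    and k: "real (Suc k) * s ^ k \<le> s powr r"
    using block_lengths[OF d_pos d_le] unfolding s_def r_def by blast
  obtain xs where xs: "set xs = BC.states" "distinct xs"
    using finite_distinct_list[OF BC.finite_states] by blast
  define n where "n = length xs"
  have ns: "real n \<le> s"
  proof -
    \<comment> \<open>\<open>m\<close> is the integer part of \<open>log 2 d\<close>. The upper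
      bound on \<open>d\<close> limits the height of stacks to \<open>Suc m\<close>; the lower one
      gives \<open>2 ^ Suc m \<le> 2 * d\<close>, so this height is at most
      \<open>log 2 (2 * d)\<close>.\<close>
    obtain m where m: "2 ^ m \<le> d" "d < 2 ^ Suc m"
      using ex_power_ivl1[of 2 d] d_pos by auto
    have "n = card BC.states" using distinct_card[OF xs(2)] by (simp add: n_def xs(1))
    then have "n \<le> t ^ Suc m + 1" using BC.states_card(2)[of "Suc m"] m(2) by (simp add: t d)
    then have "real n \<le> real (t ^ Suc m + 1)" by (simp only: of_nat_le_iff)
    also have "\<dots> = real t powr real (Suc m) + 1" using t_pos powr_realpow[of "real t" "Suc m"] by simp
    also have "\<dots> \<le> s"
    proof -
      have "real (2 ^ m) \<le> real d" using m(1) by (simp only: of_nat_le_iff)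
      then have "2 powr real (Suc m) \<le> 2 * real d" by (simp add: powr_realpow powr_add)
      then have "real (Suc m) \<le> log 2 (2 * real d)" using d_pos by (subst le_log_iff) simp_all
      then show ?thesis unfolding s_def using t_pos by (intro add_right_mono powr_mono) simp_all
    qed
    finally show ?thesis .
  qed
  have pow_le: "real n ^ e \<le> s powr p" if "real e \<le> p" for e p
  proof -
    have "real n ^ e \<le> s ^ e" using ns by (intro power_mono) simp_all
    also have "\<dots> = s powr real e" using s1 by (simp add: powr_realpow)
    also have "\<dots> \<le> s powr p" using s1 that by (intro powr_mono)
    finally show ?thesis .
  qed
  have poly: "circuit_poly C
      = mpow (set xs) (\<lambda>S S'. label_poly (BC.step S S')) (Suc k * Suc l) [out C] []"
    unfolding xs(1) by (rule BC.circuit_poly_eq_mpow) (use kl(1) d in simp)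
  have ends: "[out C] \<in> set xs" "[] \<in> set xs"
    using BC.init_state BC.final_state by (simp_all add: xs(1))
  obtain \<Gamma> where \<Gamma>: "depth_four_circuit \<Gamma>" "circuit_poly \<Gamma> = circuit_poly C" "unweighted_adds \<Gamma>"
    "num_add \<Gamma> = n ^ 2 + 1" "num_mul \<Gamma> = n ^ 2 * n ^ l + n ^ k"
    "\<And>a. a \<in> input_labels \<Gamma> \<Longrightarrow> \<exists>S\<in>set xs. \<exists>S'. a = BC.step S S'"
    "\<And>g. g \<in> set (gates \<Gamma>) \<Longrightarrow> is_mul g \<Longrightarrow> fan_in g \<in> {Suc k, Suc l}"
    using depth_four_circuit_of_mpow[OF xs(2) ends, where w = BC.step and k = k and l = l]
    unfolding poly n_def by blast
  obtain \<Gamma>f where \<Gamma>f: "depth_four_formula \<Gamma>f" "circuit_poly \<Gamma>f = circuit_poly C" "unweighted_adds \<Gamma>f"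
    "num_add \<Gamma>f = Suc k * n ^ k + 1" "num_mul \<Gamma>f = Suc k * n ^ k * n ^ l + n ^ k"
    "\<And>a. a \<in> input_labels \<Gamma>f \<Longrightarrow> \<exists>S\<in>set xs. \<exists>S'. a = BC.step S S'"
    "\<And>g. g \<in> set (gates \<Gamma>f) \<Longrightarrow> is_mul g \<Longrightarrow> fan_in g \<in> {Suc k, Suc l}"
    using depth_four_formula_of_mpow[OF xs(2) ends, where w = BC.step and k = k and l = l]
    unfolding poly n_def by blast
  have adds: "real (num_add \<Gamma>) \<le> s ^ 2 + 1"
    using power_mono[OF ns, of 2] by (simp add: \<Gamma>(4))
  have muls: "real (num_mul \<Gamma>) \<le> 2 * s powr (r + 2)"
    using pow_le[of "2 + l" "r + 2"] pow_le[of k "r + 2"] kl(2,3) by (simp add: \<Gamma>(5) power2_eq_square mult.assoc)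
  have kn: "real (Suc k) * real n ^ k \<le> s powr r"
  proof -
    have "real (Suc k) * real n ^ k \<le> real (Suc k) * s ^ k"
      using ns by (intro mult_left_mono power_mono) simp_all
    with k show ?thesis by (rule order_trans[rotated])
  qed
  then have fadds: "real (num_add \<Gamma>f) \<le> s powr r + 1"
    by (simp add: \<Gamma>f(4) algebra_simps)
  have fmuls: "real (num_mul \<Gamma>f) \<le> 2 * s powr (2 * r)"
  proof -
    have "real (Suc k) * real n ^ k * real n ^ l \<le> s powr r * s powr r"
      using kn pow_le[OF kl(3)] by (intro mult_mono) simp_all
    also have "\<dots> = s powr (2 * r)" by (simp flip: powr_add)
    finally have "real (Suc k) * real n ^ k * real n ^ l \<le> s powr (2 * r)" .
    moreover have "real n ^ k \<le> s powr (2 * r)" using kl(2) by (intro pow_le) linarith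
    moreover have "real (num_mul \<Gamma>f) = real (Suc k) * real n ^ k * real n ^ l + real n ^ k"
      by (simp add: \<Gamma>f(5) algebra_simps)
    ultimately show ?thesis by linarith
  qed
  have labels: "\<exists>S\<in>BC.states. \<exists>S'. a = BC.step S S'" if "a \<in> input_labels \<Gamma> \<union> input_labels \<Gamma>f" for a
    using that \<Gamma>(6) \<Gamma>f(6) xs(1) by blast
  have fan: "real (fan_in g) \<le> r + 1" if "g \<in> set (gates \<Gamma>) \<union> set (gates \<Gamma>f)" "is_mul g" for g
  proof -
    have "fan_in g \<in> {Suc k, Suc l}" using that \<Gamma>(7) \<Gamma>f(7) by blast
    then show ?thesis using kl(2,3) by auto
  qed
  show ?thesis
  proof (rule exI[of _ \<Gamma>], rule exI[of _ \<Gamma>f], intro conjI ballI impI allI)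
    show "a \<in> input_labels C \<or> (\<exists>c. a = Const c)" if "a \<in> input_labels \<Gamma> \<union> input_labels \<Gamma>f" for a
      using labels[OF that] BC.step_label by blast
    show "\<exists>z :: int. c = of_int z \<and> \<bar>z\<bar> \<le> 2 ^ t"
      if "constant_free C \<and> ordinary_adds C" "Const c \<in> input_labels \<Gamma> \<union> input_labels \<Gamma>f" for c
      using labels[OF that(2)] BC.step_small[OF _ that(1)] unfolding BC.small_def t by metis
  qed (use \<Gamma> \<Gamma>f adds muls fadds fmuls fan in \<open>simp_all add: s_def r_def\<close>)
qed

end
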